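(* Let $(M,d)$ be a complete pointed metric space with base point $0$, let $f : M \to M$ be a Lipschitz map with $f(0)=0$, and suppose that the associated Lipschitz operator $\widehat{f} : \mathcal{F}(M) \to \mathcal{F}(M)$ is compact. Let $A$ be the set of all integers $n \geq 1$ such that $f$ has a nonzero periodic point of order $n$ (that is, a periodic point $x \neq 0$ of order $n$). If $M$ is bounded, or if $f$ is flat at infinity, then $$\sigma(\widehat{f})\setminus\{0\} = \bigcup_{n \in A} \mathbb{U}_n, \qquad \text{where } \mathbb{U}_n = \{ z \in \mathbb{C} : z^n = 1 \}.$$
   Context: $\mathrm{Lip}_0(M)$ is the Banach space of Lipschitz functions $g : M \to \mathbb{C}$ with $g(0)=0$, with norm $\|g\|_L = \sup_{x\neq y} |g(x)-g(y)|/d(x,y)$. For $x\in M$, $\delta(x) \in \mathrm{Lip}_0(M)^*$ is evaluation at $x$, and the Lipschitz-free space is $\mathcal{F}(M) = \overline{\mathrm{span}}\{\delta(x) : x \in M\} \subset \mathrm{Lip}_0(M)^*$ (norm closure). For a Lipschitz map $f:M\to M$ with $f(0)=0$, $\widehat{f} : \mathcal{F}(M)\to\mathcal{F}(M)$ is the unique bounded linear operator with $\widehat{f}(\delta(x)) = \delta(f(x))$ for all $x \in M$. A point $x\in M$ is a periodic point of order $n\ge 1$ of $f$ if $f^n(x)=x$ and $f^k(x)\neq x$ for $1\le k\le n-1$. The map $f$ is flat at infinity if $d(f(x),f(y))/d(x,y) \to 0$ as $d(x,0)\to\infty$ and $d(y,0)\to\infty$ jointly; that is, for every $\varepsilon>0$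 there is $R>0$ such that $d(f(x),f(y)) \le \varepsilon\, d(x,y)$ for all $x,y$ with $d(x,0)\ge R$ and $d(y,0)\ge R$. $\sigma(T)$ is the spectrum of $T$. *)

theory Defs
  imports "HOL-Analysis.Analysis"
begin

section \<open>Complex normed spaces, their bounded operators and duals\<close>

class complex_normed_vector = real_normed_vector +
  fixes scaleC :: "complex \<Rightarrow> 'a \<Rightarrow> 'a"  (infixr \<open>*\<^sub>C\<close> 75)
  assumes scaleC_add_right: "c *\<^sub>C (x + y) = c *\<^sub>C x + c *\<^sub>C y"
    and scaleC_add_left: "(b + c) *\<^sub>C x = b *\<^sub>C x + c *\<^sub>C x"
    and scaleC_scaleC: "b *\<^sub>C c *\<^sub>C x = (b * c) *\<^sub>C x"
    and scaleC_of_real: "complex_of_real r *\<^sub>C x = r *\<^sub>R x"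
    and norm_scaleC: "norm (c *\<^sub>C x) = cmod c * norm x"

interpretation complex_vector: vector_space
  "scaleC :: complex \<Rightarrow> 'a \<Rightarrow> 'a::complex_normed_vector"
proof
  show "1 *\<^sub>C x = x" for x :: 'a
    using scaleC_of_real[of 1 x] by simp
qed (rule scaleC_add_right scaleC_add_left scaleC_scaleC)+

lemma bounded_linear_scaleC:
  "bounded_linear (\<lambda>x::'a::complex_normed_vector. c *\<^sub>C x)"
proof (rule bounded_linear_intro[where K = "cmod c"])
  fix r :: real and x :: 'a
  have "c *\<^sub>C r *\<^sub>R x = complex_of_real r *\<^sub>C c *\<^sub>C x"
    by (simp only: scaleC_of_real[symmetric] scaleC_scaleC mult.commute)
  then show "c *\<^sub>C r *\<^sub>R x = r *\<^sub>R c *\<^sub>C x"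
    by (simp only: scaleC_of_real)
qed (simp_all add: scaleC_add_right norm_scaleC mult.commute)

instantiation complex :: complex_normed_vector
begin
definition scaleC_complex :: "complex \<Rightarrow> complex \<Rightarrow> complex"
  where "scaleC_complex c x = c * x"
instance
  by standard (simp_all add: scaleC_complex_def algebra_simps norm_mult scaleR_conv_of_real)
end

definition bounded_clinear :: "('a::complex_normed_vector \<Rightarrow> 'b::complex_normed_vector) \<Rightarrow> bool"
  where "bounded_clinear T \<longleftrightarrow> bounded_linear T \<and> (\<forall>c x. T (c *\<^sub>C x) = c *\<^sub>C T x)"

definition compact_operator :: "('a::complex_normed_vector \<Rightarrow> 'b::complex_normed_vector) \<Rightarrow> bool"
  where "compact_operator T \<longleftrightarrow> bounded_clinear T \<and> compact (closure (T ` cball 0 1))"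

definition operator_spectrum :: "('a::complex_normed_vector \<Rightarrow> 'a) \<Rightarrow> complex set"
  where "operator_spectrum T =
    {z. \<not> (\<exists>S. bounded_clinear S \<and>
          (\<forall>x. S (T x - z *\<^sub>C x) = x) \<and> (\<forall>x. T (S x) - z *\<^sub>C S x = x))}"

text \<open>The dual consists of the complex-linear members of the real-linear bounded
  maps into the complex numbers, and so carries the operator norm.\<close>

typedef (overloaded) 'a cdual =
  "{\<phi> :: 'a::complex_normed_vector \<Rightarrow>\<^sub>L complex. \<forall>c x. \<phi> (c *\<^sub>C x) = c * \<phi> x}"
  by (rule exI[of _ 0]) simp

setup_lifting type_definition_cdual

lemma cmod_mult_le_of_inverse:
  assumes "a \<le> cmod (inverse c) * b" and "c \<noteq> 0"
  shows "cmod c * a \<le> b"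
  using mult_left_mono[OF assms(1), of "cmod c"] assms(2)
  by (simp add: norm_inverse flip: mult.assoc)

instantiation cdual :: (complex_normed_vector) complex_normed_vector
begin

lift_definition zero_cdual :: "'a cdual" is 0 by simp
lift_definition plus_cdual :: "'a cdual \<Rightarrow> 'a cdual \<Rightarrow> 'a cdual" is "(+)"
  by (simp add: blinfun.bilinear_simps algebra_simps)
lift_definition minus_cdual :: "'a cdual \<Rightarrow> 'a cdual \<Rightarrow> 'a cdual" is "(-)"
  by (simp add: blinfun.bilinear_simps algebra_simps)
lift_definition uminus_cdual :: "'a cdual \<Rightarrow> 'a cdual" is uminus
  by (simp add: blinfun.bilinear_simps)
lift_definition scaleR_cdual :: "real \<Rightarrow> 'a cdual \<Rightarrow> 'a cdual" is "(*\<^sub>R)"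
  by (simp add: blinfun.bilinear_simps)
lift_definition scaleC_cdual :: "complex \<Rightarrow> 'a cdual \<Rightarrow> 'a cdual"
  is "\<lambda>c \<phi>. blinfun_compose (blinfun_mult_right c) \<phi>"
  by simp
lift_definition norm_cdual :: "'a cdual \<Rightarrow> real" is norm .
definition dist_cdual :: "'a cdual \<Rightarrow> 'a cdual \<Rightarrow> real"
  where "dist_cdual a b = norm (a - b)"
definition sgn_cdual :: "'a cdual \<Rightarrow> 'a cdual"
  where "sgn_cdual x = scaleR (inverse (norm x)) x"
definition uniformity_cdual :: "('a cdual \<times> 'a cdual) filter"
  where "uniformity_cdual = (INF e\<in>{0<..}. principal {(x, y). dist x y < e})"
definition open_cdual :: "'a cdual set \<Rightarrow> bool"
  where "open_cdual S = (\<forall>x\<in>S. \<forall>\<^sub>F (x', y) in uniformity. x' = x \<longrightarrow> y \<in> S)"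

instance
proof
  fix c :: complex and x :: "'a cdual"
  show "norm (c *\<^sub>C x) = cmod c * norm x"
  proof transfer
    fix c :: complex and \<phi> :: "'a \<Rightarrow>\<^sub>L complex"
    show "norm (blinfun_compose (blinfun_mult_right c) \<phi>) = cmod c * norm \<phi>"
    proof (cases "c = 0")
      case True
      then have "blinfun_compose (blinfun_mult_right c) \<phi> = 0"
        by (intro blinfun_eqI) simp
      with True show ?thesis by simp
    next
      case False
      have le: "norm (blinfun_compose (blinfun_mult_right b) \<psi>) \<le> cmod b * norm \<psi>"
        for b and \<psi> :: "'a \<Rightarrow>\<^sub>L complex"
        by (rule norm_blinfun_bound)
          (auto simp: norm_mult mult.assoc intro!: mult_left_mono norm_blinfun)
      have "blinfun_compose (blinfun_mult_right (inverse c))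
              (blinfun_compose (blinfun_mult_right c) \<phi>) = \<phi>"
        using False by (intro blinfun_eqI) simp
      then have "norm \<phi> \<le> cmod (inverse c) * norm (blinfun_compose (blinfun_mult_right c) \<phi>)"
        by (metis le)
      then have "cmod c * norm \<phi> \<le> norm (blinfun_compose (blinfun_mult_right c) \<phi>)"
        using False by (rule cmod_mult_le_of_inverse)
      with le[of c \<phi>] show ?thesis by simp
    qed
  qed
next
  fix b c :: complex and r s :: real and x y z :: "'a cdual"
  show "c *\<^sub>C (x + y) = c *\<^sub>C x + c *\<^sub>C y"
    by transfer (rule blinfun_eqI, simp add: blinfun.bilinear_simps algebra_simps)
  show "(b + c) *\<^sub>C x = b *\<^sub>C x + c *\<^sub>C x"
    by transfer (rule blinfun_eqI, simp add: blinfun.bilinear_simps algebra_simps)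
  show "b *\<^sub>C c *\<^sub>C x = (b * c) *\<^sub>C x"
    by transfer (rule blinfun_eqI, simp)
  show "complex_of_real r *\<^sub>C x = r *\<^sub>R x"
    by transfer (rule blinfun_eqI, simp add: blinfun.bilinear_simps scaleR_conv_of_real)
  show "norm (x + y) \<le> norm x + norm y"
    by transfer (rule norm_triangle_ineq)
qed (unfold dist_cdual_def sgn_cdual_def open_cdual_def uniformity_cdual_def,
     (rule refl | (transfer, simp add: algebra_simps))+)

end

lift_definition cdual_apply :: "'a::complex_normed_vector cdual \<Rightarrow> 'a \<Rightarrow> complex"
  is blinfun_apply .


section \<open>The space of Lipschitz functions vanishing at the base point\<close>

text \<open>A pointed metric space is a type of sort \<open>{metric_space, zero}\<close>: class \<open>zero\<close>
  has no axioms, and its constant \<open>0\<close> is the base point.\<close>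

typedef (overloaded) 'a lip0 =
  "{g :: 'a::{metric_space,zero} \<Rightarrow> complex. (\<exists>L. L-lipschitz_on UNIV g) \<and> g 0 = 0}"
  by (rule exI[of _ "\<lambda>_. 0"]) (auto simp: lipschitz_on_def)

setup_lifting type_definition_lip0

definition lip_quotients :: "('a::metric_space \<Rightarrow> complex) \<Rightarrow> real set"
  where "lip_quotients g = (\<lambda>(x, y). cmod (g x - g y) / dist x y) ` UNIV"

lemma lipschitz_on_quotients_le:
  assumes "L-lipschitz_on UNIV g"
  shows "cmod (g x - g y) / dist x y \<le> L"
  using lipschitz_onD[OF assms, of x y] lipschitz_on_nonneg[OF assms]
  by (cases "x = y") (simp_all add: dist_norm divide_le_eq)

lemma bdd_above_lip_quotients:
  assumes "L-lipschitz_on UNIV g"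
  shows "bdd_above (lip_quotients g)"
  using lipschitz_on_quotients_le[OF assms] by (auto simp: lip_quotients_def intro!: bdd_aboveI)

lemma Sup_lip_quotients_le:
  assumes "L-lipschitz_on UNIV g"
  shows "Sup (lip_quotients g) \<le> L"
  using lipschitz_on_quotients_le[OF assms] by (auto simp: lip_quotients_def intro!: cSup_least)

lemma Sup_lip_quotients_nonneg:
  assumes "L-lipschitz_on UNIV g"
  shows "0 \<le> Sup (lip_quotients g)"
  by (rule cSup_upper[OF _ bdd_above_lip_quotients[OF assms]])
    (auto simp: lip_quotients_def intro!: image_eqI[of _ _ "(undefined, undefined)"])

lemma lipschitz_on_Sup_lip_quotients:
  assumes "L-lipschitz_on UNIV g"
  shows "(Sup (lip_quotients g))-lipschitz_on UNIV g"
proof (rule lipschitz_onI[OF _ Sup_lip_quotients_nonneg[OF assms]])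
  fix x y
  have "cmod (g x - g y) / dist x y \<le> Sup (lip_quotients g)"
    by (rule cSup_upper[OF _ bdd_above_lip_quotients[OF assms]]) (auto simp: lip_quotients_def)
  then show "dist (g x) (g y) \<le> Sup (lip_quotients g) * dist x y"
    by (cases "x = y") (simp_all add: dist_norm divide_le_eq)
qed

lemma lipschitz_on_cmult:
  assumes "L-lipschitz_on UNIV g"
  shows "(cmod c * L)-lipschitz_on UNIV (\<lambda>x. c * g x)"
proof (rule lipschitz_onI)
  fix x y
  have "dist (c * g x) (c * g y) = cmod c * dist (g x) (g y)"
    by (simp add: dist_norm norm_mult flip: right_diff_distrib)
  also have "\<dots> \<le> cmod c * (L * dist x y)"
    by (intro mult_left_mono lipschitz_onD[OF assms]) auto
  finally show "dist (c * g x) (c * g y) \<le> cmod c * L * dist x y"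
    by (simp add: mult.assoc)
qed (use lipschitz_on_nonneg[OF assms] in auto)

instantiation lip0 :: ("{metric_space,zero}") complex_normed_vector
begin

lift_definition zero_lip0 :: "'a lip0" is "\<lambda>_. 0"
  by (auto simp: lipschitz_on_def)
lift_definition plus_lip0 :: "'a lip0 \<Rightarrow> 'a lip0 \<Rightarrow> 'a lip0" is "\<lambda>g h x. g x + h x"
  by (auto intro: lipschitz_on_add)
lift_definition minus_lip0 :: "'a lip0 \<Rightarrow> 'a lip0 \<Rightarrow> 'a lip0" is "\<lambda>g h x. g x - h x"
  by (auto intro: lipschitz_on_diff)
lift_definition uminus_lip0 :: "'a lip0 \<Rightarrow> 'a lip0" is "\<lambda>g x. - g x"
  by auto
lift_definition scaleR_lip0 :: "real \<Rightarrow> 'a lip0 \<Rightarrow> 'a lip0" is "\<lambda>r g x. r *\<^sub>R g x"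
  by (auto intro: lipschitz_on_cmult simp: scaleR_conv_of_real)
lift_definition scaleC_lip0 :: "complex \<Rightarrow> 'a lip0 \<Rightarrow> 'a lip0" is "\<lambda>c g x. c * g x"
  by (auto intro: lipschitz_on_cmult)

text \<open>The supremum also ranges over \<open>x = y\<close>, where the quotient is \<open>0 / 0 = 0\<close>. This only
  matters for a one-point space, where it makes the set of quotients nonempty.\<close>

lift_definition norm_lip0 :: "'a lip0 \<Rightarrow> real" is "\<lambda>g. Sup (lip_quotients g)" .
definition dist_lip0 :: "'a lip0 \<Rightarrow> 'a lip0 \<Rightarrow> real"
  where "dist_lip0 a b = norm (a - b)"
definition sgn_lip0 :: "'a lip0 \<Rightarrow> 'a lip0"
  where "sgn_lip0 x = scaleR (inverse (norm x)) x"
definition uniformity_lip0 :: "('a lip0 \<times> 'a lip0) filter"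
  where "uniformity_lip0 = (INF e\<in>{0<..}. principal {(x, y). dist x y < e})"
definition open_lip0 :: "'a lip0 set \<Rightarrow> bool"
  where "open_lip0 S = (\<forall>x\<in>S. \<forall>\<^sub>F (x', y) in uniformity. x' = x \<longrightarrow> y \<in> S)"

instance
proof
  have norm_C: "norm (c *\<^sub>C x) = cmod c * norm x" for c and x :: "'a lip0"
  proof transfer
    fix c and g :: "'a \<Rightarrow> complex"
    assume "(\<exists>L. L-lipschitz_on UNIV g) \<and> g 0 = 0"
    then obtain L where L: "L-lipschitz_on UNIV g" by blast
    have le: "Sup (lip_quotients (\<lambda>x. b * h x)) \<le> cmod b * Sup (lip_quotients h)"
      if "K-lipschitz_on UNIV h" for b K and h :: "'a \<Rightarrow> complex"
      by (intro Sup_lip_quotients_le lipschitz_on_cmult lipschitz_on_Sup_lip_quotients[OF that])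
    show "Sup (lip_quotients (\<lambda>x. c * g x)) = cmod c * Sup (lip_quotients g)"
    proof (cases "c = 0")
      case True
      then show ?thesis
        by (simp add: lip_quotients_def case_prod_unfold)
    next
      case False
      have "Sup (lip_quotients (\<lambda>x. inverse c * (c * g x)))
          \<le> cmod (inverse c) * Sup (lip_quotients (\<lambda>x. c * g x))"
        by (rule le[OF lipschitz_on_cmult[OF L]])
      moreover have "(\<lambda>x. inverse c * (c * g x)) = g"
        using False by (simp add: fun_eq_iff)
      ultimately have "Sup (lip_quotients g)
          \<le> cmod (inverse c) * Sup (lip_quotients (\<lambda>x. c * g x))"
        by simp
      then have "cmod c * Sup (lip_quotients g) \<le> Sup (lip_quotients (\<lambda>x. c * g x))"
        using False by (rule cmod_mult_le_of_inverse)
      with le[OF L, of c] show ?thesis by simp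
    qed
  qed
  fix b c :: complex and r s :: real and x y z :: "'a lip0"
  show of_real: "complex_of_real r *\<^sub>C x = r *\<^sub>R x" for r and x :: "'a lip0"
    by transfer (simp add: scaleR_conv_of_real)
  show "norm (c *\<^sub>C x) = cmod c * norm x" by (rule norm_C)
  show "norm (r *\<^sub>R x) = \<bar>r\<bar> * norm x"
    using norm_C[of "complex_of_real r" x] by (simp add: of_real)
  show "norm x = 0 \<longleftrightarrow> x = 0"
  proof transfer
    fix g :: "'a \<Rightarrow> complex"
    assume g: "(\<exists>L. L-lipschitz_on UNIV g) \<and> g 0 = 0"
    then obtain L where L: "L-lipschitz_on UNIV g" by blast
    show "Sup (lip_quotients g) = 0 \<longleftrightarrow> g = (\<lambda>_. 0)"
    proof
      assume "Sup (lip_quotients g) = 0"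
      then have "dist (g x) (g 0) \<le> 0" for x
        using lipschitz_onD[OF lipschitz_on_Sup_lip_quotients[OF L], of x 0] by simp
      then show "g = (\<lambda>_. 0)" using g by auto
    next
      assume "g = (\<lambda>_. 0)"
      then show "Sup (lip_quotients g) = 0"
        by (simp add: lip_quotients_def case_prod_unfold)
    qed
  qed
  show "norm (x + y) \<le> norm x + norm y"
    by transfer (auto intro!: Sup_lip_quotients_le lipschitz_on_add
        intro: lipschitz_on_Sup_lip_quotients)
qed (unfold dist_lip0_def sgn_lip0_def open_lip0_def uniformity_lip0_def,
     (rule refl | (transfer, simp add: algebra_simps))+)

end

lift_definition lip0_apply :: "'a::{metric_space,zero} lip0 \<Rightarrow> 'a \<Rightarrow> complex" is "\<lambda>g. g" .

lemma lip0_apply_scaleC: "lip0_apply (c *\<^sub>C g) x = c * lip0_apply g x"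
  by transfer simp

lemma lip0_apply_base: "lip0_apply g 0 = 0"
  by transfer simp

lemma dist_lip0_apply_le: "dist (lip0_apply g x) (lip0_apply g y) \<le> norm g * dist x y"
  by transfer (meson UNIV_I lipschitz_onD lipschitz_on_Sup_lip_quotients)

lemma bounded_linear_lip0_apply: "bounded_linear (\<lambda>g. lip0_apply g x)"
proof (rule bounded_linear_intro[where K = "dist x 0"])
  show "norm (lip0_apply g x) \<le> norm g * dist x 0" for g
    using dist_lip0_apply_le[of g x 0] by (simp add: lip0_apply_base)
qed (transfer, simp)+


section \<open>The Lipschitz-free space\<close>

lift_definition eval_dual :: "'a::{metric_space,zero} \<Rightarrow> 'a lip0 cdual"
  is "\<lambda>x. Blinfun (\<lambda>g. lip0_apply g x)"
  by (simp add: bounded_linear_Blinfun_apply[OF bounded_linear_lip0_apply] lip0_apply_scaleC)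

lemma cdual_apply_eval_dual: "cdual_apply (eval_dual x) g = lip0_apply g x"
  by transfer (simp add: bounded_linear_Blinfun_apply[OF bounded_linear_lip0_apply])

lemma csubspace_closure:
  fixes S :: "'a::complex_normed_vector set"
  assumes "complex_vector.subspace S"
  shows "complex_vector.subspace (closure S)"
proof (rule complex_vector.subspaceI)
  show "0 \<in> closure S"
    using complex_vector.subspace_0[OF assms] closure_subset by blast
  show "x + y \<in> closure S" if x: "x \<in> closure S" and y: "y \<in> closure S" for x y
  proof -
    obtain u where u: "\<forall>n. u n \<in> S" "u \<longlonglongrightarrow> x"
      using x unfolding closure_sequential by blast
    obtain v where v: "\<forall>n. v n \<in> S" "v \<longlonglongrightarrow> y"
      using y unfolding closure_sequential by blast
    from u v show ?thesis
      unfolding closure_sequential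
      by (intro exI[of _ "\<lambda>n. u n + v n"])
        (auto intro: tendsto_add complex_vector.subspace_add[OF assms])
  qed
  show "c *\<^sub>C x \<in> closure S" if x: "x \<in> closure S" for c x
  proof -
    obtain u where "\<forall>n. u n \<in> S" "u \<longlonglongrightarrow> x"
      using x unfolding closure_sequential by blast
    then show ?thesis
      unfolding closure_sequential
      by (intro exI[of _ "\<lambda>n. c *\<^sub>C u n"])
        (auto intro: bounded_linear.tendsto[OF bounded_linear_scaleC]
          complex_vector.subspace_scale[OF assms])
  qed
qed

definition lipfree_set :: "'a::{metric_space,zero} lip0 cdual set"
  where "lipfree_set = closure (complex_vector.span (range eval_dual))"

lemma subspace_lipfree_set: "complex_vector.subspace lipfree_set"
  unfolding lipfree_set_def by (intro csubspace_closure complex_vector.subspace_span)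

lemmas lipfree_set_closed =
  complex_vector.subspace_0[OF subspace_lipfree_set]
  complex_vector.subspace_add[OF subspace_lipfree_set]
  complex_vector.subspace_diff[OF subspace_lipfree_set]
  complex_vector.subspace_neg[OF subspace_lipfree_set]
  complex_vector.subspace_scale[OF subspace_lipfree_set]
  complex_vector.subspace_scale[OF subspace_lipfree_set, of _ "complex_of_real r" for r,
    unfolded scaleC_of_real]

typedef (overloaded) 'a lipfree = "lipfree_set :: 'a::{metric_space,zero} lip0 cdual set"
  using lipfree_set_closed(1) by blast

setup_lifting type_definition_lipfree

instantiation lipfree :: ("{metric_space,zero}") complex_normed_vector
begin

lift_definition zero_lipfree :: "'a lipfree" is 0 by (rule lipfree_set_closed)
lift_definition plus_lipfree :: "'a lipfree \<Rightarrow> 'a lipfree \<Rightarrow> 'a lipfree" is "(+)"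
  by (rule lipfree_set_closed)
lift_definition minus_lipfree :: "'a lipfree \<Rightarrow> 'a lipfree \<Rightarrow> 'a lipfree" is "(-)"
  by (rule lipfree_set_closed)
lift_definition uminus_lipfree :: "'a lipfree \<Rightarrow> 'a lipfree" is uminus
  by (rule lipfree_set_closed)
lift_definition scaleR_lipfree :: "real \<Rightarrow> 'a lipfree \<Rightarrow> 'a lipfree" is "(*\<^sub>R)"
  by (rule lipfree_set_closed)
lift_definition scaleC_lipfree :: "complex \<Rightarrow> 'a lipfree \<Rightarrow> 'a lipfree" is "(*\<^sub>C)"
  by (rule lipfree_set_closed)
lift_definition norm_lipfree :: "'a lipfree \<Rightarrow> real" is norm .
definition dist_lipfree :: "'a lipfree \<Rightarrow> 'a lipfree \<Rightarrow> real"
  where "dist_lipfree a b = norm (a - b)"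
definition sgn_lipfree :: "'a lipfree \<Rightarrow> 'a lipfree"
  where "sgn_lipfree x = scaleR (inverse (norm x)) x"
definition uniformity_lipfree :: "('a lipfree \<times> 'a lipfree) filter"
  where "uniformity_lipfree = (INF e\<in>{0<..}. principal {(x, y). dist x y < e})"
definition open_lipfree :: "'a lipfree set \<Rightarrow> bool"
  where "open_lipfree S = (\<forall>x\<in>S. \<forall>\<^sub>F (x', y) in uniformity. x' = x \<longrightarrow> y \<in> S)"

instance
proof
  fix x y :: "'a lipfree"
  show "norm (x + y) \<le> norm x + norm y"
    by transfer (rule norm_triangle_ineq)
qed (unfold dist_lipfree_def sgn_lipfree_def open_lipfree_def uniformity_lipfree_def,
     (rule refl | (transfer, simp add: algebra_simps scaleC_add_right scaleC_add_left
       scaleC_scaleC scaleC_of_real norm_scaleC))+)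

end

lift_definition lipfree_delta :: "'a::{metric_space,zero} \<Rightarrow> 'a lipfree" is eval_dual
  unfolding lipfree_set_def
  by (meson closure_subset complex_vector.span_base rangeI subsetD)

lemma eval_dual_in_lipfree_set: "eval_dual x \<in> lipfree_set"
  using Rep_lipfree[of "lipfree_delta x"] by (simp add: lipfree_delta.rep_eq)

lemma csubspace_span_induct:
  assumes "u \<in> closure (complex_vector.span S)" and "S \<subseteq> V"
    and "complex_vector.subspace V" and "closed V"
  shows "u \<in> V"
  using assms by (meson closure_minimal complex_vector.span_minimal subsetD)

lemma norm_Rep_lipfree: "norm (Rep_lipfree u) = norm u"
  by (simp add: norm_lipfree.rep_eq)

lemma closure_span_lipfree_delta:
  "closure (complex_vector.span (range lipfree_delta)) = UNIV"
proof (rule UNIV_eq_I[symmetric])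
  fix u :: "'a lipfree"
  have lift: "\<exists>v \<in> complex_vector.span (range lipfree_delta). Rep_lipfree v = \<phi>"
    if "\<phi> \<in> complex_vector.span (range eval_dual)" for \<phi> :: "'a lip0 cdual"
    using that
  proof (induction rule: complex_vector.span_induct_alt)
    case base
    show ?case
      by (rule bexI[of _ 0]) (simp_all add: zero_lipfree.rep_eq complex_vector.span_zero)
  next
    case (step c \<psi> \<phi>)
    then obtain v x where v: "v \<in> complex_vector.span (range lipfree_delta)"
      and eq: "Rep_lipfree v = \<phi>" "\<psi> = eval_dual x"
      by blast
    have "c *\<^sub>C lipfree_delta x + v \<in> complex_vector.span (range lipfree_delta)"
      by (intro complex_vector.span_add complex_vector.span_scale v
          complex_vector.span_base rangeI)
    then show ?case
      by (rule bexI[rotated])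
        (simp add: eq plus_lipfree.rep_eq scaleC_lipfree.rep_eq lipfree_delta.rep_eq)
  qed
  show "u \<in> closure (complex_vector.span (range lipfree_delta))"
    unfolding closure_approachable
  proof (intro allI impI)
    fix e :: real
    assume "e > 0"
    have "Rep_lipfree u \<in> closure (complex_vector.span (range eval_dual))"
      using Rep_lipfree[of u] by (simp add: lipfree_set_def)
    with \<open>e > 0\<close> obtain \<phi> where "\<phi> \<in> complex_vector.span (range eval_dual)"
      and *: "dist \<phi> (Rep_lipfree u) < e"
      unfolding closure_approachable by blast
    with lift obtain v where "v \<in> complex_vector.span (range lipfree_delta)"
      and "Rep_lipfree v = \<phi>"
      by blast
    with * show "\<exists>v\<in>complex_vector.span (range lipfree_delta). dist v u < e"
      by (intro bexI[of _ v])
        (simp_all add: dist_norm norm_lipfree.rep_eq minus_lipfree.rep_eq)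
  qed
qed

lemma bounded_clinear_eq_on_lipfree_delta:
  fixes S T :: "'a::{metric_space,zero} lipfree \<Rightarrow> 'b::complex_normed_vector"
  assumes S: "bounded_clinear S" and T: "bounded_clinear T"
    and eq: "\<And>x. S (lipfree_delta x) = T (lipfree_delta x)"
  shows "S = T"
proof
  fix u
  have lin: "linear S" "linear T" and cont: "continuous_on UNIV S" "continuous_on UNIV T"
    and scale: "\<And>c x. S (c *\<^sub>C x) = c *\<^sub>C S x" "\<And>c x. T (c *\<^sub>C x) = c *\<^sub>C T x"
    using S T by (auto simp: bounded_clinear_def bounded_linear.linear linear_continuous_on)
  have "u \<in> {u. S u = T u}"
  proof (rule csubspace_span_induct[where S = "range lipfree_delta"])
    show "u \<in> closure (complex_vector.span (range lipfree_delta))"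
      by (simp add: closure_span_lipfree_delta)
    show "complex_vector.subspace {u. S u = T u}"
      by (rule complex_vector.subspaceI)
        (simp_all add: lin[THEN linear_0] lin[THEN linear_add] scale)
    show "closed {u. S u = T u}"
      by (rule closed_Collect_eq[OF cont])
  qed (auto simp: eq)
  then show "S u = T u" by simp
qed

lemma bounded_clinear_cdual_apply: "bounded_clinear (cdual_apply \<phi>)"
  unfolding bounded_clinear_def scaleC_complex_def
  by transfer (simp add: blinfun.bounded_linear_right)

lemma norm_cdual_apply_le: "cmod (cdual_apply \<phi> x) \<le> norm \<phi> * norm x"
  by transfer (rule norm_blinfun)

definition cadjoint ::
    "('a::complex_normed_vector \<Rightarrow> 'b::complex_normed_vector) \<Rightarrow> 'b cdual \<Rightarrow> 'a cdual"
  where "cadjoint C \<phi> = Abs_cdual (Blinfun (\<lambda>x. cdual_apply \<phi> (C x)))"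

lemma cdual_apply_cadjoint:
  assumes "bounded_clinear C"
  shows "cdual_apply (cadjoint C \<phi>) x = cdual_apply \<phi> (C x)"
proof -
  have bl: "bounded_linear (\<lambda>x. cdual_apply \<phi> (C x))"
    using assms bounded_clinear_cdual_apply[of \<phi>]
    by (auto simp: bounded_clinear_def intro: bounded_linear_compose)
  have "cdual_apply \<phi> (C (c *\<^sub>C x)) = c * cdual_apply \<phi> (C x)" for c x
    using assms bounded_clinear_cdual_apply[of \<phi>]
    by (simp add: bounded_clinear_def scaleC_complex_def)
  then have "Blinfun (\<lambda>x. cdual_apply \<phi> (C x))
      \<in> {\<phi>. \<forall>c x. blinfun_apply \<phi> (c *\<^sub>C x) = c * blinfun_apply \<phi> x}"
    by (simp add: bounded_linear_Blinfun_apply[OF bl])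
  then have "Rep_cdual (cadjoint C \<phi>) = Blinfun (\<lambda>x. cdual_apply \<phi> (C x))"
    unfolding cadjoint_def by (rule Abs_cdual_inverse)
  then have "cdual_apply (cadjoint C \<phi>) x = blinfun_apply (Blinfun (\<lambda>x. cdual_apply \<phi> (C x))) x"
    by (simp only: cdual_apply.rep_eq)
  then show ?thesis
    by (simp only: bounded_linear_Blinfun_apply[OF bl])
qed

lemma cdual_eqI: "(\<And>x. cdual_apply \<phi> x = cdual_apply \<psi> x) \<Longrightarrow> \<phi> = \<psi>"
  by transfer (rule blinfun_eqI)

lemma cdual_apply_simps:
  "cdual_apply (\<phi> + \<psi>) x = cdual_apply \<phi> x + cdual_apply \<psi> x"
  "cdual_apply (r *\<^sub>R \<phi>) x = r *\<^sub>R cdual_apply \<phi> x"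
  "cdual_apply (c *\<^sub>C \<phi>) x = c * cdual_apply \<phi> x"
  by (transfer, simp add: blinfun.bilinear_simps)+

lemma norm_cdual_bound:
  assumes "0 \<le> b" and "\<And>x. cmod (cdual_apply \<phi> x) \<le> b * norm x"
  shows "norm \<phi> \<le> b"
  using assms by transfer (rule norm_blinfun_bound)

lemma bounded_clinear_cadjoint:
  assumes "bounded_clinear C"
  shows "bounded_clinear (cadjoint C)"
  unfolding bounded_clinear_def
proof (intro conjI allI)
  have bl: "bounded_linear C"
    using assms by (simp add: bounded_clinear_def)
  show "bounded_linear (cadjoint C)"
  proof (rule bounded_linear_intro[where K = "onorm C"])
    show "norm (cadjoint C \<phi>) \<le> norm \<phi> * onorm C" for \<phi>
    proof (rule norm_cdual_bound)
      fix x
      have "cmod (cdual_apply \<phi> (C x)) \<le> norm \<phi> * norm (C x)"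
        by (rule norm_cdual_apply_le)
      also have "\<dots> \<le> norm \<phi> * (onorm C * norm x)"
        by (intro mult_left_mono onorm bl) auto
      finally show "cmod (cdual_apply (cadjoint C \<phi>) x) \<le> norm \<phi> * onorm C * norm x"
        by (simp add: cdual_apply_cadjoint[OF assms] mult.assoc)
    qed (simp add: onorm_pos_le[OF bl])
  qed (rule cdual_eqI, simp add: cdual_apply_cadjoint[OF assms] cdual_apply_simps)+
qed (rule cdual_eqI, simp add: cdual_apply_cadjoint[OF assms] cdual_apply_simps)

definition lip0_compose :: "('a::{metric_space,zero} \<Rightarrow> 'a) \<Rightarrow> 'a lip0 \<Rightarrow> 'a lip0"
  where "lip0_compose f g = Abs_lip0 (\<lambda>x. lip0_apply g (f x))"

lemma lip0_eqI: "(\<And>x. lip0_apply g x = lip0_apply h x) \<Longrightarrow> g = h"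
  by transfer (rule ext)

lemma lip0_apply_simps:
  "lip0_apply (g + h) x = lip0_apply g x + lip0_apply h x"
  "lip0_apply (r *\<^sub>R g) x = r *\<^sub>R lip0_apply g x"
  "lip0_apply (c *\<^sub>C g) x = c * lip0_apply g x"
  by (transfer, simp)+

lemma norm_lip0_bound: "L-lipschitz_on UNIV (lip0_apply g) \<Longrightarrow> norm g \<le> L"
  by transfer (rule Sup_lip_quotients_le)

context
  fixes f :: "'a::{metric_space,zero} \<Rightarrow> 'a" and L :: real
  assumes L: "L-lipschitz_on UNIV f" and base: "f 0 = 0"
begin

lemma lipschitz_on_compose_lip0: "(norm g * L)-lipschitz_on UNIV (\<lambda>x. lip0_apply g (f x))"
proof (rule lipschitz_onI)
  fix x y
  have "dist (lip0_apply g (f x)) (lip0_apply g (f y)) \<le> norm g * dist (f x) (f y)"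
    by (rule dist_lip0_apply_le)
  also have "\<dots> \<le> norm g * (L * dist x y)"
    by (intro mult_left_mono lipschitz_onD[OF L]) auto
  finally show "dist (lip0_apply g (f x)) (lip0_apply g (f y)) \<le> norm g * L * dist x y"
    by (simp add: mult.assoc)
qed (simp add: lipschitz_on_nonneg[OF L])

lemma lip0_apply_compose: "lip0_apply (lip0_compose f g) x = lip0_apply g (f x)"
proof -
  have "(\<lambda>x. lip0_apply g (f x)) \<in> {g. (\<exists>L. L-lipschitz_on UNIV g) \<and> g 0 = 0}"
    using lipschitz_on_compose_lip0 base lip0_apply_base by auto
  then show ?thesis
    by (simp add: lip0_compose_def lip0_apply.rep_eq Abs_lip0_inverse)
qed

lemma bounded_clinear_lip0_compose: "bounded_clinear (lip0_compose f)"
  unfolding bounded_clinear_def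
proof (intro conjI allI)
  show "bounded_linear (lip0_compose f)"
  proof (rule bounded_linear_intro[where K = L])
    show "norm (lip0_compose f g) \<le> norm g * L" for g
      using lipschitz_on_compose_lip0[of g]
      by (intro norm_lip0_bound) (simp add: lip0_apply_compose[abs_def])
  qed (rule lip0_eqI, simp add: lip0_apply_compose lip0_apply_simps)+
qed (rule lip0_eqI, simp add: lip0_apply_compose lip0_apply_simps)

lemma cadjoint_lip0_compose_eval_dual:
  "cadjoint (lip0_compose f) (eval_dual x) = eval_dual (f x)"
  by (rule cdual_eqI)
    (simp add: cdual_apply_cadjoint[OF bounded_clinear_lip0_compose] cdual_apply_eval_dual
      lip0_apply_compose)

lemma cadjoint_lip0_compose_lipfree_set:
  assumes "\<phi> \<in> lipfree_set"
  shows "cadjoint (lip0_compose f) \<phi> \<in> lipfree_set"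
proof -
  let ?T = "cadjoint (lip0_compose f)"
  have T: "linear ?T" "continuous_on UNIV ?T" "\<And>c x. ?T (c *\<^sub>C x) = c *\<^sub>C ?T x"
    using bounded_clinear_cadjoint[OF bounded_clinear_lip0_compose]
    by (auto simp: bounded_clinear_def bounded_linear.linear linear_continuous_on)
  have "\<phi> \<in> ?T -` lipfree_set"
  proof (rule csubspace_span_induct[where S = "range eval_dual"])
    show "\<phi> \<in> closure (complex_vector.span (range eval_dual))"
      using assms by (simp add: lipfree_set_def)
    show "range eval_dual \<subseteq> ?T -` lipfree_set"
      by (auto simp: cadjoint_lip0_compose_eval_dual eval_dual_in_lipfree_set)
    show "complex_vector.subspace (?T -` lipfree_set)"
      by (rule complex_vector.subspaceI)
        (simp_all add: linear_0[OF T(1)] linear_add[OF T(1)] T(3) lipfree_set_closed)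
    show "closed (?T -` lipfree_set)"
      by (rule closed_vimage[OF _ T(2)]) (simp add: lipfree_set_def)
  qed
  then show ?thesis by simp
qed

lemma lipfree_map_unique_existence:
  "\<exists>!T. bounded_clinear T \<and> (\<forall>x. T (lipfree_delta x) = lipfree_delta (f x))"
proof (rule ex_ex1I)
  let ?A = "cadjoint (lip0_compose f)"
  define T where "T = (\<lambda>u. Abs_lipfree (?A (Rep_lipfree u)))"
  have Rep_T: "Rep_lipfree (T u) = ?A (Rep_lipfree u)" for u
    unfolding T_def
    by (intro Abs_lipfree_inverse cadjoint_lip0_compose_lipfree_set Rep_lipfree)
  have A: "bounded_linear ?A" "\<And>c x. ?A (c *\<^sub>C x) = c *\<^sub>C ?A x"
    using bounded_clinear_cadjoint[OF bounded_clinear_lip0_compose]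
    by (auto simp: bounded_clinear_def)
  interpret A: bounded_linear ?A by (rule A)
  have eqI: "u = v" if "Rep_lipfree u = Rep_lipfree v" for u v :: "'a lipfree"
    using that by (simp add: Rep_lipfree_inject)
  have "bounded_linear T"
  proof (rule bounded_linear_intro[where K = "onorm ?A"])
    show "norm (T u) \<le> norm u * onorm ?A" for u
      using onorm[OF A(1), of "Rep_lipfree u"]
      by (simp add: Rep_T mult.commute flip: norm_Rep_lipfree)
  qed (rule eqI, simp only: Rep_T plus_lipfree.rep_eq scaleR_lipfree.rep_eq A.add A.scaleR)+
  moreover have "T (c *\<^sub>C u) = c *\<^sub>C T u" for c u
    by (rule eqI) (simp only: Rep_T scaleC_lipfree.rep_eq A)
  moreover have "T (lipfree_delta x) = lipfree_delta (f x)" for x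
    by (rule eqI) (simp only: Rep_T lipfree_delta.rep_eq cadjoint_lip0_compose_eval_dual)
  ultimately show "\<exists>T. bounded_clinear T \<and> (\<forall>x. T (lipfree_delta x) = lipfree_delta (f x))"
    unfolding bounded_clinear_def by blast
qed (auto intro!: bounded_clinear_eq_on_lipfree_delta)

end

definition lipfree_map :: "('a::{metric_space,zero} \<Rightarrow> 'a) \<Rightarrow> 'a lipfree \<Rightarrow> 'a lipfree"
  where "lipfree_map f =
    (THE T. bounded_clinear T \<and> (\<forall>x. T (lipfree_delta x) = lipfree_delta (f x)))"

lemma lipfree_map:
  assumes "L-lipschitz_on UNIV f" and "f 0 = 0"
  shows "bounded_clinear (lipfree_map f)"
    and "lipfree_map f (lipfree_delta x) = lipfree_delta (f x)"
  using theI'[OF lipfree_map_unique_existence[OF assms]]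
  by (simp_all flip: lipfree_map_def)


section \<open>Periodic points and flatness at infinity\<close>

definition periodic_point_of_order :: "('a \<Rightarrow> 'a) \<Rightarrow> nat \<Rightarrow> 'a \<Rightarrow> bool"
  where "periodic_point_of_order f n x \<longleftrightarrow>
    n \<ge> 1 \<and> (f ^^ n) x = x \<and> (\<forall>k. 1 \<le> k \<and> k \<le> n - 1 \<longrightarrow> (f ^^ k) x \<noteq> x)"

definition flat_at_infinity :: "('a::{metric_space,zero} \<Rightarrow> 'a) \<Rightarrow> bool"
  where "flat_at_infinity f \<longleftrightarrow>
    (\<forall>\<epsilon>>0. \<exists>R>0. \<forall>x y. dist x 0 \<ge> R \<and> dist y 0 \<ge> R \<longrightarrow> dist (f x) (f y) \<le> \<epsilon> * dist x y)"

end

theory Submission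
  imports Defs
begin

text \<open>Write \<open>T\<close> for the operator \<open>lipfree_map f\<close>. The roots of unity are eigenvalues: over a cycle
  \<open>x, f x, ..., f\<^sup>n x = x\<close> of nonzero points and for \<open>z\<^sup>n = 1\<close>, the combination
  \<open>\<Sum>k<n. z\<^sup>-\<^sup>k \<delta>(f\<^sup>k x)\<close> is an eigenvector (\<open>root_of_unity_in_spectrum\<close>).

  For the other inclusion, compactness of \<open>T\<close> has two metric consequences. Images under \<open>f\<close> of
  bounded sets are totally bounded, because \<open>\<delta>\<close> is isometric. And \<open>f\<close> contracts by any prescribed
  factor at small scales (\<open>uniformly_locally_flat_of_compact\<close>): for two close points,
  \<open>(\<delta>(u) - \<delta>(v)) / d(u, v)\<close> has pairing 1 with a uniformly small Lipschitz function, to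
  which finitely supported elements hardly respond, and so it stays away from any finite set of
  them; without such contraction, a multiple bounded below would lie in the relatively compact
  image of the unit ball. A bounded space is flat at infinity for trivial reasons, so both alternatives of the theorem are treated at once;
  flatness makes a large ball attract every orbit. Inside it, the pigeonhole principle and the
  contraction principle bring every orbit close to a periodic point after a bounded number of
  steps, the periodic points being finite in number, and from then on the distance to the
  periodic orbit decays faster than any geometric sequence.

  Hence, if a Lipschitz map \<open>E\<close> on the space vanishes at all periodic points, then the Lipschitz
  constant of \<open>E \<circ> f\<^sup>k\<close> is at most \<open>C \<epsilon>\<^sup>k\<close>, for every \<open>\<epsilon>\<close> (\<open>superexponential_decay\<close>). This
  applies to \<open>E(x) = W \<delta>(x)\<close> with \<open>W\<close> the product of the \<open>T\<^sup>n - 1\<close> over the finitely many periods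
  \<open>n\<close> of nonzero periodic points, and says that \<open>norm (T\<^sup>k W) \<le> C \<epsilon>\<^sup>k\<close>. For \<open>z \<noteq> 0\<close> and
  \<open>\<epsilon> < \<bar>z\<bar>\<close> the series
  \<open>- (\<Sum>k. z\<^sup>-\<^sup>k\<^sup>-\<^sup>1 T\<^sup>k W)\<close> therefore converges to some \<open>S\<close> with \<open>(T - z) S = W\<close>. Polynomial
  division of \<open>W\<close> by \<open>T - z\<close> gives \<open>(T - z) V = W - w\<close> with \<open>w\<close> the product of the \<open>z\<^sup>n - 1\<close>.
  Subtracting, \<open>(S - V) / w\<close> inverts \<open>T - z\<close> unless \<open>z\<close> is one of the roots of unity
  (\<open>not_in_operator_spectrum\<close>). Compactness enters only through the metric properties of \<open>f\<close>; the
  spectral theory of compact operators is replaced by this explicit inverse.\<close>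


section \<open>Completeness of the Lipschitz-free space\<close>

text \<open>Completeness of the Lipschitz-free space makes the series that inverts \<open>T - z\<close> converge. It is
  inherited from the real-linear bounded maps, since complex linearity and membership in a closed
  span pass to limits.\<close>

instance cdual :: (complex_normed_vector) banach
proof
  fix X :: "nat \<Rightarrow> 'a cdual"
  assume X: "Cauchy X"
  have norm_Rep: "dist (Rep_cdual a) (Rep_cdual b) = dist a b" for a b :: "'a cdual"
    by (simp add: dist_norm norm_cdual.rep_eq minus_cdual.rep_eq)
  have "Cauchy (\<lambda>n. Rep_cdual (X n))"
    using X by (simp add: Cauchy_def norm_Rep)
  then obtain \<phi> where \<phi>: "(\<lambda>n. Rep_cdual (X n)) \<longlonglongrightarrow> \<phi>"
    by (meson Cauchy_convergent convergent_def)
  have ap: "(\<lambda>n. blinfun_apply (Rep_cdual (X n)) x) \<longlonglongrightarrow> blinfun_apply \<phi> x" for x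
    by (intro tendsto_intros \<phi>)
  have "blinfun_apply \<phi> (c *\<^sub>C x) = c * blinfun_apply \<phi> x" for c x
  proof (rule LIMSEQ_unique[OF ap])
    have "blinfun_apply (Rep_cdual (X n)) (c *\<^sub>C x) = c * blinfun_apply (Rep_cdual (X n)) x" for n
      using Rep_cdual[of "X n"] by simp
    then show "(\<lambda>n. blinfun_apply (Rep_cdual (X n)) (c *\<^sub>C x)) \<longlonglongrightarrow> c * blinfun_apply \<phi> x"
      by (simp add: tendsto_mult_left[OF ap])
  qed
  then have "Rep_cdual (Abs_cdual \<phi>) = \<phi>"
    by (intro Abs_cdual_inverse) simp
  then obtain \<psi> where "\<phi> = Rep_cdual \<psi>"
    by (rule that[OF sym])
  with \<phi> have "X \<longlonglongrightarrow> \<psi>"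
    by (simp add: tendsto_iff norm_Rep)
  then show "convergent X"
    by (auto simp: convergent_def)
qed

instance lipfree :: ("{metric_space,zero}") banach
proof
  fix X :: "nat \<Rightarrow> 'a lipfree"
  assume X: "Cauchy X"
  have norm_Rep: "dist (Rep_lipfree a) (Rep_lipfree b) = dist a b" for a b :: "'a lipfree"
    by (simp add: dist_norm norm_lipfree.rep_eq minus_lipfree.rep_eq)
  have "Cauchy (\<lambda>n. Rep_lipfree (X n))"
    using X by (simp add: Cauchy_def norm_Rep)
  then obtain \<phi> where \<phi>: "(\<lambda>n. Rep_lipfree (X n)) \<longlonglongrightarrow> \<phi>"
    by (meson Cauchy_convergent convergent_def)
  have "closed (lipfree_set :: 'a lip0 cdual set)"
    by (simp add: lipfree_set_def)
  then have "\<phi> \<in> lipfree_set"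
    by (rule closed_sequentially[OF _ Rep_lipfree \<phi>])
  then obtain \<psi> where "\<phi> = Rep_lipfree \<psi>"
    by (rule Rep_lipfree_cases)
  with \<phi> have "X \<longlonglongrightarrow> \<psi>"
    by (simp add: tendsto_iff norm_Rep)
  then show "convergent X"
    by (auto simp: convergent_def)
qed


section \<open>The duality with Lipschitz functions\<close>

definition lipfree_pairing :: "'a::{metric_space,zero} lipfree \<Rightarrow> 'a lip0 \<Rightarrow> complex"
  where "lipfree_pairing u g = cdual_apply (Rep_lipfree u) g"

lemma lipfree_pairing_delta: "lipfree_pairing (lipfree_delta x) g = lip0_apply g x"
  by (simp add: lipfree_pairing_def lipfree_delta.rep_eq cdual_apply_eval_dual)

lemma cmod_lipfree_pairing_le: "cmod (lipfree_pairing u g) \<le> norm u * norm g"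
  by (simp add: lipfree_pairing_def norm_cdual_apply_le flip: norm_Rep_lipfree)

lemma bounded_clinear_lipfree_pairing: "bounded_clinear (\<lambda>u. lipfree_pairing u g)"
  unfolding bounded_clinear_def scaleC_complex_def
proof (intro conjI allI)
  show "bounded_linear (\<lambda>u. lipfree_pairing u g)"
  proof (rule bounded_linear_intro[where K = "norm g"])
    show "norm (lipfree_pairing u g) \<le> norm u * norm g" for u
      by (rule cmod_lipfree_pairing_le)
  qed (simp_all add: lipfree_pairing_def plus_lipfree.rep_eq scaleR_lipfree.rep_eq
        cdual_apply_simps)
qed (simp add: lipfree_pairing_def scaleC_lipfree.rep_eq cdual_apply_simps)

lemma norm_lipfree_bound:
  assumes "0 \<le> b" and "\<And>g. cmod (lipfree_pairing u g) \<le> b * norm g"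
  shows "norm u \<le> b"
  using norm_cdual_bound[of b "Rep_lipfree u"] assms
  by (simp add: lipfree_pairing_def norm_Rep_lipfree)

lemma bounded_clinearD:
  assumes "bounded_clinear T"
  shows "bounded_linear T" and "T (c *\<^sub>C x) = c *\<^sub>C T x"
    and "T (x + y) = T x + T y" and "T (x - y) = T x - T y" and "T 0 = 0"
    and "T (r *\<^sub>R x) = r *\<^sub>R T x"
  using assms
  by (auto simp: bounded_clinear_def bounded_linear.linear linear_add linear_diff linear_0
      linear_scale)

lemma lip0_of_lipschitz:
  assumes "L-lipschitz_on UNIV h" and "h 0 = 0"
  obtains g where "norm g \<le> L" and "\<And>x. lip0_apply g x = h x"
proof -
  have "lip0_apply (Abs_lip0 h) = h"
    unfolding lip0_apply.rep_eq using assms by (intro Abs_lip0_inverse) auto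
  with assms show ?thesis
    by (intro that[of "Abs_lip0 h"]) (auto intro: norm_lip0_bound)
qed

lemma lip0_of_real_lipschitz:
  fixes h :: "'a::{metric_space,zero} \<Rightarrow> real"
  assumes "\<And>x y. \<bar>h x - h y\<bar> \<le> dist x y"
  obtains g where "norm g \<le> 1" and "\<And>x. lip0_apply g x = complex_of_real (h x - h 0)"
proof (rule lip0_of_lipschitz)
  show "1-lipschitz_on UNIV (\<lambda>x. complex_of_real (h x - h 0))"
    using assms by (auto intro!: lipschitz_onI simp: dist_norm simp flip: of_real_diff)
qed (auto intro: that)

lemma lipfree_delta_base: "lipfree_delta 0 = 0"
proof -
  have "norm (lipfree_delta (0::'a)) \<le> 0"
    by (rule norm_lipfree_bound) (simp_all add: lipfree_pairing_delta lip0_apply_base)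
  then show ?thesis by simp
qed

text \<open>The lower bound is attained at the distance function from one of the two points.\<close>

lemma dist_lipfree_delta: "dist (lipfree_delta x) (lipfree_delta y) = dist x y"
proof (rule antisym)
  show "dist (lipfree_delta x) (lipfree_delta y) \<le> dist x y"
    unfolding dist_norm[of "lipfree_delta x"]
  proof (rule norm_lipfree_bound)
    show "cmod (lipfree_pairing (lipfree_delta x - lipfree_delta y) g) \<le> dist x y * norm g" for g
      using dist_lip0_apply_le[of g x y]
      by (simp add: bounded_clinearD(4)[OF bounded_clinear_lipfree_pairing]
          lipfree_pairing_delta dist_norm mult.commute)
  qed simp
  obtain g where g: "norm g \<le> 1"
    "\<And>z. lip0_apply g z = complex_of_real (dist z y - dist 0 y)"
  proof (rule lip0_of_real_lipschitz[of "\<lambda>z. dist z y"])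
    show "\<bar>dist a y - dist b y\<bar> \<le> dist a b" for a b
      by (metis abs_dist_diff_le dist_commute)
  qed auto
  have "dist x y = cmod (lip0_apply g x - lip0_apply g y)"
    unfolding g of_real_diff[symmetric] by simp
  also have "\<dots> = cmod (lipfree_pairing (lipfree_delta x - lipfree_delta y) g)"
    by (simp add: bounded_clinearD(4)[OF bounded_clinear_lipfree_pairing] lipfree_pairing_delta)
  also have "\<dots> \<le> norm (lipfree_delta x - lipfree_delta y) * norm g"
    by (rule cmod_lipfree_pairing_le)
  also have "\<dots> \<le> dist (lipfree_delta x) (lipfree_delta y)"
    using g(1) by (simp add: dist_norm mult_left_le)
  finally show "dist x y \<le> dist (lipfree_delta x) (lipfree_delta y)" .
qed

lemma bounded_clinear_compose:
  assumes "bounded_clinear S" and "bounded_clinear T"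
  shows "bounded_clinear (\<lambda>x. S (T x))"
  using assms by (auto simp: bounded_clinear_def intro: bounded_linear_compose)

lemma bounded_clinear_id: "bounded_clinear (\<lambda>x. x)"
  by (simp add: bounded_clinear_def bounded_linear_ident)

lemma bounded_clinear_zero: "bounded_clinear (\<lambda>x. 0)"
  by (simp add: bounded_clinear_def bounded_linear_zero)

lemma bounded_clinear_add:
  assumes "bounded_clinear S" and "bounded_clinear T"
  shows "bounded_clinear (\<lambda>x. S x + T x)"
  using assms by (auto simp: bounded_clinear_def scaleC_add_right intro: bounded_linear_add)

lemma bounded_clinear_diff:
  assumes "bounded_clinear S" and "bounded_clinear T"
  shows "bounded_clinear (\<lambda>x. S x - T x)"
  using assms
  by (auto simp: bounded_clinear_def complex_vector.scale_right_diff_distrib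
      intro: bounded_linear_sub)

lemma bounded_clinear_scaleC:
  assumes "bounded_clinear T"
  shows "bounded_clinear (\<lambda>x. c *\<^sub>C T x)"
  using assms bounded_linear_compose[OF bounded_linear_scaleC[of c]]
  by (auto simp: bounded_clinear_def scaleC_scaleC mult.commute)

lemma bounded_clinear_funpow:
  fixes T :: "'a::complex_normed_vector \<Rightarrow> 'a"
  assumes "bounded_clinear T"
  shows "bounded_clinear (T ^^ n)"
proof (induction n)
  case 0
  show ?case using bounded_clinear_id by (simp add: id_def)
next
  case (Suc n)
  show ?case using bounded_clinear_compose[OF assms Suc.IH] by (simp add: o_def)
qed

text \<open>The adjoint of \<open>U\<close> sends a Lipschitz function \<open>g\<close> to \<open>x \<mapsto> \<langle>U \<delta>(x), g\<rangle>\<close>, so its norm is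
  controlled by the Lipschitz constant of \<open>U \<circ> \<delta>\<close>. Norm estimates for operators thereby become
  metric estimates for point orbits.\<close>

lemma norm_le_of_lipfree_delta_lipschitz:
  fixes U :: "'a::{metric_space,zero} lipfree \<Rightarrow> 'b::{metric_space,zero} lipfree"
  assumes U: "bounded_clinear U" and C: "0 \<le> C"
    and lip: "\<And>x y. norm (U (lipfree_delta x) - U (lipfree_delta y)) \<le> C * dist x y"
  shows "norm (U u) \<le> C * norm u"
proof (rule norm_lipfree_bound)
  fix g :: "'b lip0"
  have pU: "bounded_clinear (\<lambda>u. lipfree_pairing (U u) g)"
    by (rule bounded_clinear_compose[OF bounded_clinear_lipfree_pairing U])
  obtain k where k: "norm k \<le> C * norm g"
    "\<And>x. lip0_apply k x = lipfree_pairing (U (lipfree_delta x)) g"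
  proof (rule lip0_of_lipschitz)
    show "(C * norm g)-lipschitz_on UNIV (\<lambda>x. lipfree_pairing (U (lipfree_delta x)) g)"
    proof (rule lipschitz_onI)
      fix x y
      have "dist (lipfree_pairing (U (lipfree_delta x)) g) (lipfree_pairing (U (lipfree_delta y)) g)
          = cmod (lipfree_pairing (U (lipfree_delta x) - U (lipfree_delta y)) g)"
        by (simp add: dist_norm bounded_clinearD(4)[OF bounded_clinear_lipfree_pairing])
      also have "\<dots> \<le> norm (U (lipfree_delta x) - U (lipfree_delta y)) * norm g"
        by (rule cmod_lipfree_pairing_le)
      also have "\<dots> \<le> C * dist x y * norm g"
        by (intro mult_right_mono lip) auto
      finally show "dist (lipfree_pairing (U (lipfree_delta x)) g)
          (lipfree_pairing (U (lipfree_delta y)) g) \<le> C * norm g * dist x y"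
        by (simp add: mult_ac)
    qed (simp add: C)
    show "lipfree_pairing (U (lipfree_delta 0)) g = 0"
      using bounded_clinearD(5)[OF pU] by (simp add: lipfree_delta_base)
  qed auto
  have "(\<lambda>u. lipfree_pairing (U u) g) = (\<lambda>u. lipfree_pairing u k)"
    by (rule bounded_clinear_eq_on_lipfree_delta[OF pU bounded_clinear_lipfree_pairing])
      (simp add: lipfree_pairing_delta k)
  then have "cmod (lipfree_pairing (U u) g) \<le> norm u * norm k"
    by (metis cmod_lipfree_pairing_le)
  also have "\<dots> \<le> norm u * (C * norm g)"
    by (intro mult_left_mono k) auto
  finally show "cmod (lipfree_pairing (U u) g) \<le> C * norm u * norm g"
    by (simp add: mult_ac)
qed (simp add: C)


section \<open>Consequences of compactness\<close>

definition uniformly_locally_flat :: "('a::metric_space \<Rightarrow> 'a) \<Rightarrow> bool"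
  where "uniformly_locally_flat f \<longleftrightarrow>
    (\<forall>\<epsilon>>0. \<exists>\<delta>>0. \<forall>x y. dist x y < \<delta> \<longrightarrow> dist (f x) (f y) \<le> \<epsilon> * dist x y)"

lemma totally_bounded_compact_operator_image:
  assumes "compact_operator T"
  shows "totally_bounded (T ` cball 0 1)"
proof (rule totally_bounded_subset[OF _ closure_subset])
  show "totally_bounded (closure (T ` cball 0 1))"
    using assms
    by (simp add: compact_operator_def compact_eq_totally_bounded totally_bounded_metric ball_def)
qed

text \<open>The form in which total boundedness enters pigeonhole arguments.\<close>

lemma totally_bounded_colouring:
  fixes S :: "'a::metric_space set"
  assumes "totally_bounded S" and "0 < \<eta>"
  obtains K :: "'a set" and c where "finite K" and "c ` S \<subseteq> K"
    and "\<And>y z. y \<in> S \<Longrightarrow> z \<in> S \<Longrightarrow> c y = c z \<Longrightarrow> dist y z < \<eta>"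
proof -
  obtain K where K: "finite K" "S \<subseteq> (\<Union>x\<in>K. {y. dist x y < \<eta> / 2})"
    using assms unfolding totally_bounded_metric by (meson half_gt_zero)
  have "\<forall>y\<in>S. \<exists>x. x \<in> K \<and> dist x y < \<eta> / 2"
    using K(2) by blast
  then obtain c where c: "\<forall>y\<in>S. c y \<in> K \<and> dist (c y) y < \<eta> / 2"
    by metis
  show ?thesis
  proof (rule that[OF K(1), of c])
    show "dist y z < \<eta>" if "y \<in> S" "z \<in> S" "c y = c z" for y z
      using c that by (metis dist_triangle_half_r)
  qed (use c in auto)
qed

lemma totally_bounded_lipschitz_image_cball:
  fixes f :: "'a::{metric_space,zero} \<Rightarrow> 'a"
  assumes lip: "L-lipschitz_on UNIV f" and base: "f 0 = 0"
    and comp: "compact_operator (lipfree_map f)"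
  shows "totally_bounded (f ` cball 0 R)"
  unfolding totally_bounded_metric
proof (intro allI impI)
  fix e :: real
  assume "e > 0"
  define r where "r = \<bar>R\<bar> + 1"
  have r: "r > 0" "R \<le> r" by (auto simp: r_def)
  note T = lipfree_map[OF lip base]
  obtain K and c :: "'a lipfree \<Rightarrow> 'a lipfree" where K: "finite K" "c ` (lipfree_map f ` cball 0 1) \<subseteq> K"
    "\<And>y z. y \<in> lipfree_map f ` cball 0 1 \<Longrightarrow> z \<in> lipfree_map f ` cball 0 1 \<Longrightarrow> c y = c z \<Longrightarrow>
      dist y z < e / r"
    using totally_bounded_colouring[OF totally_bounded_compact_operator_image[OF comp], of "e / r"]
      \<open>e > 0\<close> r(1) by (metis divide_pos_pos)
  define v where "v x = (1 / r) *\<^sub>R lipfree_delta (f x)" for x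
  have v: "v x \<in> lipfree_map f ` cball 0 1" if "x \<in> cball 0 R" for x
  proof
    show "v x = lipfree_map f ((1 / r) *\<^sub>R lipfree_delta x)"
      by (simp add: v_def T(2) bounded_clinearD(6)[OF T(1)])
    have "norm (lipfree_delta x) = dist x 0"
      using dist_lipfree_delta[of x 0] by (simp add: lipfree_delta_base)
    with that r show "(1 / r) *\<^sub>R lipfree_delta x \<in> cball 0 1"
      by (simp add: dist_commute)
  qed
  have dist_v: "dist (v x) (v y) = dist (f x) (f y) / r" for x y
    using r(1) dist_lipfree_delta[of "f x" "f y"]
    by (simp add: v_def dist_norm flip: scaleR_diff_right)
  \<comment> \<open>Choose one point of the ball for each colour that occurs.\<close>
  have "finite ((\<lambda>x. c (v x)) ` cball 0 R)"
    by (rule finite_subset[OF _ K(1)]) (use K(2) v in blast)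
  then obtain F where F: "F \<subseteq> cball 0 R" "finite F"
    "(\<lambda>x. c (v x)) ` cball 0 R = (\<lambda>x. c (v x)) ` F"
    by (meson finite_subset_image subset_refl)
  show "\<exists>k. finite k \<and> f ` cball 0 R \<subseteq> (\<Union>x\<in>k. {y. dist x y < e})"
  proof (intro exI[of _ "f ` F"] conjI subsetI)
    show "finite (f ` F)" using F(2) by simp
    fix y assume "y \<in> f ` cball 0 R"
    then obtain x where x: "x \<in> cball 0 R" "y = f x" by blast
    then obtain x' where x': "x' \<in> F" "c (v x) = c (v x')" 
    using F(3) by (metis (no_types, lifting) image_iff)
    then have "dist (v x') (v x) < e / r"
      using F(1) x v by (intro K(3)) auto
    then have "dist (f x') y < e"
      using r(1) x(2) by (simp add: dist_v divide_less_cancel)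
    with x'(1) show "y \<in> (\<Union>x\<in>f ` F. {y. dist x y < e})" by blast
  qed
qed

text \<open>A finitely supported element sees only finitely many values of \<open>g\<close>, so it is continuous for the
  supremum norm, unlike a general element of the Lipschitz-free space.\<close>

lemma lipfree_span_delta_sup_bound:
  assumes "\<mu> \<in> complex_vector.span (range lipfree_delta)"
  shows "\<exists>C\<ge>0. \<forall>g s. (\<forall>x. cmod (lip0_apply g x) \<le> s) \<longrightarrow> cmod (lipfree_pairing \<mu> g) \<le> C * s"
  using assms
proof (induction rule: complex_vector.span_induct_alt)
  case base
  show ?case
    by (rule exI[of _ 0]) (simp add: bounded_clinearD(5)[OF bounded_clinear_lipfree_pairing])
next
  case (step c \<psi> \<mu>)
  then obtain C x where C: "C \<ge> 0" "\<psi> = lipfree_delta x"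
    "\<And>g s. (\<forall>x. cmod (lip0_apply g x) \<le> s) \<Longrightarrow> cmod (lipfree_pairing \<mu> g) \<le> C * s"
    by blast
  show ?case
  proof (intro exI[of _ "cmod c + C"] conjI allI impI)
    fix g :: "'a lip0" and s
    assume s: "\<forall>x. cmod (lip0_apply g x) \<le> s"
    have "lipfree_pairing (c *\<^sub>C \<psi> + \<mu>) g = c * lip0_apply g x + lipfree_pairing \<mu> g"
      by (simp add: bounded_clinearD(2,3)[OF bounded_clinear_lipfree_pairing] C(2)
          lipfree_pairing_delta scaleC_complex_def)
    also have "cmod \<dots> \<le> cmod c * cmod (lip0_apply g x) + cmod (lipfree_pairing \<mu> g)"
      by (metis norm_mult norm_triangle_ineq)
    also have "\<dots> \<le> cmod c * s + C * s"
      using s C(3) by (intro add_mono mult_left_mono) auto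
    finally show "cmod (lipfree_pairing (c *\<^sub>C \<psi> + \<mu>) g) \<le> (cmod c + C) * s"
      by (simp add: distrib_right)
  qed (use C(1) in auto)
qed

text \<open>By compactness, the images \<open>v\<close> of all normalised differences \<open>(\<delta>(x) - \<delta>(y)) / d(x, y)\<close> lie within
  \<open>\<epsilon>/2\<close> of finitely many finitely supported elements. If \<open>x\<close> and \<open>y\<close> are close, then so are
  \<open>f x\<close> and \<open>f y\<close>, and the truncated distance to \<open>f y\<close> is uniformly so small that these finitely
  many elements give it a value of at most \<open>\<epsilon>/2\<close>; but its pairing with \<open>v\<close> is
  \<open>d(f x, f y) / d(x, y)\<close>.\<close>

lemma uniformly_locally_flat_of_compact:
  fixes f :: "'a::{metric_space,zero} \<Rightarrow> 'a"
  assumes lip: "L-lipschitz_on UNIV f" and base: "f 0 = 0"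
    and comp: "compact_operator (lipfree_map f)"
  shows "uniformly_locally_flat f"
  unfolding uniformly_locally_flat_def
proof (intro allI impI)
  fix \<epsilon> :: real
  assume "\<epsilon> > 0"
  note T = lipfree_map[OF lip base]
  have L: "L \<ge> 0" by (rule lipschitz_on_nonneg[OF lip])
  obtain K where K: "finite K" "lipfree_map f ` cball 0 1 \<subseteq> (\<Union>x\<in>K. {y. dist x y < \<epsilon> / 4})"
    using totally_bounded_compact_operator_image[OF comp] \<open>\<epsilon> > 0\<close>
    unfolding totally_bounded_metric by (meson divide_pos_pos zero_less_numeral)
  have "\<forall>k. \<exists>m. m \<in> complex_vector.span (range lipfree_delta) \<and> dist m k < \<epsilon> / 4"
    using closure_span_lipfree_delta \<open>\<epsilon> > 0\<close>
    by (metis UNIV_I closure_approachable divide_pos_pos zero_less_numeral)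
  then obtain m :: "'a lipfree \<Rightarrow> 'a lipfree"
    where m: "\<And>k. m k \<in> complex_vector.span (range lipfree_delta)" "\<And>k. dist (m k) k < \<epsilon> / 4"
    by metis
  obtain D where D: "\<And>k. D k \<ge> 0"
    "\<And>k g s. (\<forall>x. cmod (lip0_apply g x) \<le> s) \<Longrightarrow> cmod (lipfree_pairing (m k) g) \<le> D k * s"
    using lipfree_span_delta_sup_bound[OF m(1)] by metis
  \<comment> \<open>A sum instead of a maximum, so that an empty \<open>K\<close> needs no separate treatment.\<close>
  define C where "C = (\<Sum>k\<in>K. D k)"
  have C: "D k \<le> C" if "k \<in> K" for k
    unfolding C_def using that K(1) D(1) by (intro member_le_sum) auto
  have "C \<ge> 0" by (simp add: C_def D(1) sum_nonneg)
  define \<delta> where "\<delta> = \<epsilon> / (2 * (C * L + 1))"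
  have den: "C * L + 1 > 0" using \<open>C \<ge> 0\<close> L by (simp add: add_nonneg_pos)
  have "\<delta> > 0" using den \<open>\<epsilon> > 0\<close> by (simp add: \<delta>_def)
  have CL\<delta>: "C * (L * \<delta>) \<le> \<epsilon> / 2"
    using den \<open>\<epsilon> > 0\<close> by (simp add: \<delta>_def field_simps)
  show "\<exists>\<delta>>0. \<forall>x y. dist x y < \<delta> \<longrightarrow> dist (f x) (f y) \<le> \<epsilon> * dist x y"
  proof (intro exI[of _ \<delta>] conjI allI impI \<open>\<delta> > 0\<close>)
    fix x y :: 'a
    assume xy: "dist x y < \<delta>"
    show "dist (f x) (f y) \<le> \<epsilon> * dist x y"
    proof (cases "x = y")
      case True
      then show ?thesis by simp
    next
      case False
      define t where "t = dist x y"
      define s where "s = dist (f x) (f y)"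
      have t: "t > 0" using False by (simp add: t_def)
      have s: "0 \<le> s" "s \<le> L * \<delta>"
        using lipschitz_onD[OF lip, of x y] mult_left_mono[OF less_imp_le[OF xy] L]
        by (auto simp: s_def)
      define v where "v = (1 / t) *\<^sub>R (lipfree_delta (f x) - lipfree_delta (f y))"
      have "v = lipfree_map f ((1 / t) *\<^sub>R (lipfree_delta x - lipfree_delta y))"
        by (simp add: v_def T(2) bounded_clinearD(4,6)[OF T(1)])
      moreover have "(1 / t) *\<^sub>R (lipfree_delta x - lipfree_delta y) \<in> cball 0 1"
        using t by (simp add: t_def dist_lipfree_delta flip: dist_norm)
      ultimately have "v \<in> lipfree_map f ` cball 0 1" by blast
      then obtain k where k: "k \<in> K" "dist k v < \<epsilon> / 4" using K(2) by blast
      have vm: "norm (v - m k) \<le> \<epsilon> / 2"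
        using dist_triangle[of v "m k" k] k(2) m(2)[of k] by (simp add: dist_norm norm_minus_commute)
      \<comment> \<open>A test function that sees the whole distance between the two image points although
        it is uniformly small.\<close>
      define h where "h z = min (dist z (f y)) s" for z
      obtain g where g: "norm g \<le> 1" "\<And>z. lip0_apply g z = complex_of_real (h z - h 0)"
      proof (rule lip0_of_real_lipschitz[of h])
        show "\<bar>h a - h b\<bar> \<le> dist a b" for a b
          using dist_triangle[of a "f y" b] dist_triangle[of b "f y" a]
          by (auto simp: h_def min_def dist_commute)
      qed auto
      have "cmod (lip0_apply g z) \<le> s" for z
      proof -
        have "0 \<le> h z" "h z \<le> s" "0 \<le> h 0" "h 0 \<le> s"
          using s(1) by (auto simp: h_def)
        then show ?thesis unfolding g norm_of_real by linarith
      qed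
      then have "cmod (lipfree_pairing (m k) g) \<le> D k * s" by (intro D(2)) auto
      also have "\<dots> \<le> C * (L * \<delta>)"
        using s C[OF k(1)] D(1) \<open>C \<ge> 0\<close> by (intro mult_mono) auto
      finally have mk: "cmod (lipfree_pairing (m k) g) \<le> \<epsilon> / 2" using CL\<delta> by simp
      note lin = bounded_clinear_lipfree_pairing[of g]
      have "lip0_apply g (f x) - lip0_apply g (f y) = complex_of_real s"
        unfolding g of_real_diff[symmetric] using s(1) by (simp add: h_def s_def)
      then have "lipfree_pairing v g = complex_of_real (s / t)"
        by (simp add: v_def bounded_clinearD(4,6)[OF lin] lipfree_pairing_delta scaleR_conv_of_real)
      then have "s / t = cmod (lipfree_pairing (v - m k) g + lipfree_pairing (m k) g)"
        using s t by (simp add: bounded_clinearD(4)[OF lin] del: of_real_divide)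
      also have "\<dots> \<le> cmod (lipfree_pairing (v - m k) g) + cmod (lipfree_pairing (m k) g)"
        by (rule norm_triangle_ineq)
      also have "\<dots> \<le> norm (v - m k) * norm g + \<epsilon> / 2"
        by (intro add_mono cmod_lipfree_pairing_le mk)
      also have "\<dots> \<le> \<epsilon> / 2 * 1 + \<epsilon> / 2"
        using vm g(1) \<open>\<epsilon> > 0\<close> by (intro add_mono mult_mono) auto
      finally have "s / t \<le> \<epsilon>" by simp
      then show ?thesis using t by (simp add: s_def t_def divide_le_eq)
    qed
  qed
qed


section \<open>Orbits of a uniformly locally flat map\<close>

definition periodic_points :: "('a \<Rightarrow> 'a) \<Rightarrow> 'a set"
  where "periodic_points f = {x. \<exists>n\<ge>1. (f ^^ n) x = x}"

lemma funpow_fixed_mult: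
  assumes "(f ^^ n) x = x"
  shows "(f ^^ (n * k)) x = x"
  using assms by (induction k) (simp_all add: funpow_add)

lemma periodic_points_funpow:
  assumes "q \<in> periodic_points f"
  shows "(f ^^ k) q \<in> periodic_points f"
proof -
  obtain n where n: "n \<ge> 1" "(f ^^ n) q = q"
    using assms by (auto simp: periodic_points_def)
  have "(f ^^ n) ((f ^^ k) q) = (f ^^ k) ((f ^^ n) q)"
    by (metis add.commute comp_apply funpow_add)
  with n show ?thesis
    by (auto simp: periodic_points_def)
qed

lemma dist_funpow_le:
  fixes f :: "'a::metric_space \<Rightarrow> 'a"
  assumes flat: "\<And>x y. dist x y < \<delta> \<Longrightarrow> dist (f x) (f y) \<le> \<epsilon> * dist x y"
    and \<epsilon>: "0 \<le> \<epsilon>" "\<epsilon> \<le> 1" and xy: "dist x y < \<delta>"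
  shows "dist ((f ^^ k) x) ((f ^^ k) y) \<le> \<epsilon> ^ k * dist x y"
proof (induction k)
  case (Suc k)
  have "\<epsilon> ^ k * dist x y \<le> 1 * dist x y"
    using \<epsilon> by (intro mult_right_mono power_le_one) auto
  with Suc.IH xy have "dist ((f ^^ k) x) ((f ^^ k) y) < \<delta>" by simp
  then have "dist ((f ^^ Suc k) x) ((f ^^ Suc k) y) \<le> \<epsilon> * dist ((f ^^ k) x) ((f ^^ k) y)"
    using flat by simp
  also have "\<dots> \<le> \<epsilon> * (\<epsilon> ^ k * dist x y)"
    using \<epsilon>(1) Suc.IH by (intro mult_left_mono) auto
  finally show ?case by (simp add: mult.assoc)
qed simp

text \<open>Among more points of an orbit in \<open>f ` B\<close> than there are small pieces covering that set, two are
  close, say \<open>y\<close> and its image \<open>f\<^sup>m y\<close>. On a ball of radius \<open>\<delta>/4\<close> around \<open>y\<close> all distances are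
  below \<open>\<delta>\<close>, so \<open>f\<^sup>m\<close> is a contraction of that ball, provided it moves the centre by at most half
  the radius; its fixed point is the periodic point sought.\<close>

lemma orbit_approaches_periodic_point:
  fixes f :: "'a::complete_space \<Rightarrow> 'a"
  assumes flat: "\<And>x y. dist x y < \<delta> \<Longrightarrow> dist (f x) (f y) \<le> \<epsilon> * dist x y"
    and \<epsilon>: "0 \<le> \<epsilon>" "\<epsilon> \<le> 1/2" and \<delta>: "0 < \<delta>"
    and tb: "totally_bounded (f ` B)" and inv: "f ` B \<subseteq> B"
  shows "\<exists>N. \<forall>x\<in>B. \<exists>i\<le>N. \<exists>q\<in>periodic_points f. dist ((f ^^ i) x) q < \<delta>"
proof -
  obtain K and c :: "'a \<Rightarrow> 'a" where K: "finite K" "c ` f ` B \<subseteq> K"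
    "\<And>y z. y \<in> f ` B \<Longrightarrow> z \<in> f ` B \<Longrightarrow> c y = c z \<Longrightarrow> dist y z < \<delta> / 8"
    using totally_bounded_colouring[OF tb, of "\<delta> / 8"] \<delta> by (metis divide_pos_pos zero_less_numeral)
  have "\<exists>i\<le>Suc (card K). \<exists>q\<in>periodic_points f. dist ((f ^^ i) x) q < \<delta>" if "x \<in> B" for x
  proof -
    have orbB: "(f ^^ i) x \<in> B" for i
      using \<open>x \<in> B\<close> inv by (induction i) auto
    have orb: "(f ^^ i) x \<in> f ` B" if "i \<in> {1..Suc (card K)}" for i
      using that orbB[of "i - 1"] by (cases i) auto
    have "(\<lambda>i. c ((f ^^ i) x)) ` {1..Suc (card K)} \<subseteq> K"
      using K(2) orb by blast
    then have "card ((\<lambda>i. c ((f ^^ i) x)) ` {1..Suc (card K)}) \<le> card K"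
      by (rule card_mono[OF K(1)])
    then have "\<not> inj_on (\<lambda>i. c ((f ^^ i) x)) {1..Suc (card K)}"
      by (intro pigeonhole) simp
    then obtain i j where ij: "i \<in> {1..Suc (card K)}" "j \<in> {1..Suc (card K)}" "i < j"
      "c ((f ^^ i) x) = c ((f ^^ j) x)"
      unfolding inj_on_def by (metis nat_neq_iff)
    define y where "y = (f ^^ i) x"
    define m where "m = j - i"
    define \<rho> where "\<rho> = \<delta> / 4"
    have m: "m \<ge> 1" using ij(3) by (simp add: m_def)
    have "(f ^^ m) y = (f ^^ j) x"
      using ij(3) by (metis comp_apply funpow_add le_add_diff_inverse2 less_imp_le m_def y_def)
    then have ym: "dist y ((f ^^ m) y) < \<rho> / 2"
      using K(3)[OF orb[OF ij(1)] orb[OF ij(2)] ij(4)] by (simp add: y_def \<rho>_def)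
    have "\<epsilon> ^ m \<le> \<epsilon>"
      using power_decreasing[OF m, of \<epsilon>] \<epsilon> by simp
    have contr: "dist ((f ^^ m) a) ((f ^^ m) b) \<le> 1/2 * dist a b" if "dist a b < \<delta>" for a b
    proof -
      have "dist ((f ^^ m) a) ((f ^^ m) b) \<le> \<epsilon> ^ m * dist a b"
        using dist_funpow_le[OF flat _ _ that] \<epsilon> by simp
      also have "\<dots> \<le> 1/2 * dist a b"
        using \<open>\<epsilon> ^ m \<le> \<epsilon>\<close> \<epsilon> by (intro mult_right_mono) auto
      finally show ?thesis .
    qed
    have "\<exists>!q. q \<in> cball y \<rho> \<and> (f ^^ m) q = q"
    proof (rule Banach_fix[where c = "1/2"])
      show "complete (cball y \<rho>)" by (simp add: complete_eq_closed)
      show "cball y \<rho> \<noteq> {}" using \<delta> by (simp add: \<rho>_def)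
      show "(f ^^ m) ` cball y \<rho> \<subseteq> cball y \<rho>"
      proof (rule image_subsetI)
        fix z assume z: "z \<in> cball y \<rho>"
        then have "dist ((f ^^ m) y) ((f ^^ m) z) \<le> 1/2 * dist y z"
          using \<delta> by (intro contr) (simp add: \<rho>_def)
        with z ym dist_triangle[of y "(f ^^ m) z" "(f ^^ m) y"]
        show "(f ^^ m) z \<in> cball y \<rho>" by simp
      qed
      show "dist ((f ^^ m) a) ((f ^^ m) b) \<le> 1/2 * dist a b"
        if "a \<in> cball y \<rho>" "b \<in> cball y \<rho>" for a b
      proof (rule contr)
        show "dist a b < \<delta>"
          using that dist_triangle3[of a b y] \<delta> by (simp add: \<rho>_def)
      qed
    qed auto
    then obtain q where "q \<in> cball y \<rho>" "(f ^^ m) q = q" by blast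
    with m \<delta> have "q \<in> periodic_points f" "dist ((f ^^ i) x) q < \<delta>"
      by (auto simp: periodic_points_def \<rho>_def y_def)
    with ij(1) show ?thesis by auto
  qed
  then show ?thesis by blast
qed

text \<open>Local contraction keeps distinct periodic points at distance at least \<open>\<delta>\<close> from each other.\<close>

lemma finite_periodic_points:
  fixes f :: "'a::metric_space \<Rightarrow> 'a"
  assumes flat: "\<And>x y. dist x y < \<delta> \<Longrightarrow> dist (f x) (f y) \<le> \<epsilon> * dist x y"
    and \<epsilon>: "0 \<le> \<epsilon>" "\<epsilon> \<le> 1/2" and \<delta>: "0 < \<delta>"
    and tb: "totally_bounded S" and sub: "periodic_points f \<subseteq> S"
  shows "finite (periodic_points f)"
proof -
  obtain K and c :: "'a \<Rightarrow> 'a" where K: "finite K" "c ` S \<subseteq> K"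
    "\<And>y z. y \<in> S \<Longrightarrow> z \<in> S \<Longrightarrow> c y = c z \<Longrightarrow> dist y z < \<delta>"
    using totally_bounded_colouring[OF tb \<delta>] by metis
  have "inj_on c (periodic_points f)"
  proof (rule inj_onI)
    fix p q
    assume pq: "p \<in> periodic_points f" "q \<in> periodic_points f" "c p = c q"
    then have "dist p q < \<delta>" using sub by (intro K(3)) auto
    obtain m n where mn: "m \<ge> 1" "n \<ge> 1" "(f ^^ m) p = p" "(f ^^ n) q = q"
      using pq by (auto simp: periodic_points_def)
    \<comment> \<open>Both points return after a common period, over which distances shrink.\<close>
    have "dist p q = dist ((f ^^ (m * n)) p) ((f ^^ (m * n)) q)"
      using funpow_fixed_mult[OF mn(3), of n] funpow_fixed_mult[OF mn(4), of m]
      by (simp add: mult.commute)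
    also have "\<dots> \<le> \<epsilon> ^ (m * n) * dist p q"
      using dist_funpow_le[OF flat _ _ \<open>dist p q < \<delta>\<close>] \<epsilon> by simp
    also have "\<dots> \<le> \<epsilon> ^ 1 * dist p q"
      using mn \<epsilon> by (intro mult_right_mono power_decreasing) auto
    also have "\<dots> \<le> 1/2 * dist p q"
      using \<epsilon> by (intro mult_right_mono) auto
    finally show "p = q" by simp
  qed
  moreover have "c ` periodic_points f \<subseteq> K" using sub K(2) by blast
  ultimately show ?thesis
    using K(1) by (metis finite_imageD finite_subset)
qed

lemma flat_at_infinity_of_bounded:
  fixes f :: "'a::{metric_space,zero} \<Rightarrow> 'a"
  assumes "bounded (UNIV :: 'a set)"
  shows "flat_at_infinity f"
proof -
  obtain b where b: "\<And>x::'a. dist 0 x \<le> b"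
    using assms bounded_any_center[of UNIV "0::'a"] by auto
  have "\<not> b + 1 \<le> dist x 0" for x :: 'a
    using b[of x] by (simp add: dist_commute)
  moreover have "b + 1 > 0" using b[of 0] by simp
  ultimately show ?thesis unfolding flat_at_infinity_def by blast
qed

text \<open>Comparing with one fixed point outside the ball of flatness gives an affine bound
  \<open>d(f(x), 0) \<le> (\<epsilon>/2) d(x, 0) + C\<close>, whose linear part dominates far away; if there is no such
  point, the space is bounded and the bound is trivial.\<close>

lemma flat_at_infinity_attracting_ball:
  fixes f :: "'a::{metric_space,zero} \<Rightarrow> 'a"
  assumes lip: "L-lipschitz_on UNIV f" and base: "f 0 = 0"
    and inf: "flat_at_infinity f" and \<epsilon>: "0 < \<epsilon>" "\<epsilon> \<le> 1"
  obtains R where "r \<le> R" and "0 < R"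
    and "\<And>x. R \<le> dist x 0 \<Longrightarrow> dist (f x) 0 \<le> \<epsilon> * dist x 0"
    and "\<And>x. dist x 0 \<le> R \<Longrightarrow> dist (f x) 0 \<le> R"
    and "\<And>x y. R \<le> dist x 0 \<Longrightarrow> R \<le> dist y 0 \<Longrightarrow> dist (f x) (f y) \<le> \<epsilon> * dist x y"
proof -
  have L: "L \<ge> 0" by (rule lipschitz_on_nonneg[OF lip])
  obtain R1 where R1: "R1 > 0"
    "\<And>x y. R1 \<le> dist x 0 \<Longrightarrow> R1 \<le> dist y 0 \<Longrightarrow> dist (f x) (f y) \<le> \<epsilon> / 2 * dist x y"
    using inf \<epsilon>(1) unfolding flat_at_infinity_def by (meson half_gt_zero)
  have lip0: "dist (f x) 0 \<le> L * dist x 0" for x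
    using lipschitz_onD[OF lip, of x 0] base by simp
  have "\<exists>C\<ge>0. \<forall>x. dist (f x) 0 \<le> \<epsilon> / 2 * dist x 0 + C"
  proof (cases "\<exists>y::'a. R1 \<le> dist y 0")
    case True
    then obtain y :: 'a where y: "R1 \<le> dist y 0" by blast
    define C where "C = \<epsilon> / 2 * dist y 0 + dist (f y) 0 + L * R1"
    have LR: "0 \<le> L * R1" using L R1(1) by simp
    have "dist (f x) 0 \<le> \<epsilon> / 2 * dist x 0 + C" for x
    proof (cases "R1 \<le> dist x 0")
      case True
      have "dist (f x) 0 \<le> dist (f x) (f y) + dist (f y) 0" by (rule dist_triangle)
      also have "\<dots> \<le> \<epsilon> / 2 * dist x y + dist (f y) 0"
        using R1(2)[OF True y] by simp
      also have "\<dots> \<le> \<epsilon> / 2 * (dist x 0 + dist y 0) + dist (f y) 0"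
        using \<epsilon>(1) dist_triangle2[of x y 0] by (intro add_right_mono mult_left_mono) auto
      finally show ?thesis using LR by (simp add: C_def algebra_simps)
    next
      case False
      then have "dist (f x) 0 \<le> L * R1"
        using lip0[of x] L by (meson less_imp_le mult_left_mono not_le order_trans)
      moreover have "0 \<le> \<epsilon> / 2 * dist x 0" "0 \<le> \<epsilon> / 2 * dist y 0" using \<epsilon>(1) by auto
      moreover have "0 \<le> dist (f y) 0" by simp
      ultimately show ?thesis unfolding C_def by linarith
    qed
    moreover have "C \<ge> 0" using LR \<epsilon>(1) by (simp add: C_def)
    ultimately show ?thesis by blast
  next
    case False
    have "dist (f x) 0 \<le> \<epsilon> / 2 * dist x 0 + L * R1" for x
    proof -
      have "dist x 0 \<le> R1" using False by (meson less_imp_le not_le)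
      then have "dist (f x) 0 \<le> L * R1"
        using lip0[of x] L by (meson mult_left_mono order_trans)
      moreover have "0 \<le> \<epsilon> / 2 * dist x 0" using \<epsilon>(1) by simp
      ultimately show ?thesis by linarith
    qed
    moreover have "0 \<le> L * R1" using L R1(1) by simp
    ultimately show ?thesis by blast
  qed
  then obtain C where C: "C \<ge> 0" "\<And>x. dist (f x) 0 \<le> \<epsilon> / 2 * dist x 0 + C" by blast
  define R where "R = max (max r R1) (2 * C / \<epsilon>)"
  have R: "r \<le> R" "R1 \<le> R" "2 * C / \<epsilon> \<le> R" by (auto simp: R_def)
  have CR: "C \<le> \<epsilon> / 2 * R"
    using R(3) \<epsilon>(1) by (simp add: field_simps)
  show ?thesis
  proof (rule that[OF R(1)])
    show "0 < R" using R1(1) R(2) by simp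
    show "dist (f x) 0 \<le> \<epsilon> * dist x 0" if "R \<le> dist x 0" for x
    proof -
      have "\<epsilon> / 2 * R \<le> \<epsilon> / 2 * dist x 0" using that \<epsilon>(1) by (intro mult_left_mono) auto
      with C(2)[of x] CR show ?thesis by simp
    qed
    show "dist (f x) 0 \<le> R" if "dist x 0 \<le> R" for x
    proof -
      have "\<epsilon> / 2 * dist x 0 \<le> \<epsilon> / 2 * R" using that \<epsilon>(1) by (intro mult_left_mono) auto
      moreover have "\<epsilon> * R \<le> 1 * R"
        using \<epsilon>(2) \<open>0 < R\<close> by (intro mult_right_mono) auto
      ultimately show ?thesis using C(2)[of x] CR by simp
    qed
    show "dist (f x) (f y) \<le> \<epsilon> * dist x y" if "R \<le> dist x 0" "R \<le> dist y 0" for x y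
    proof -
      have "dist (f x) (f y) \<le> \<epsilon> / 2 * dist x y" using that R(2) by (intro R1(2)) auto
      also have "\<dots> \<le> \<epsilon> * dist x y" using \<epsilon>(1) by (intro mult_right_mono) auto
      finally show ?thesis .
    qed
  qed
qed

lemma periodic_points_in_attracting_ball:
  fixes f :: "'a::{metric_space,zero} \<Rightarrow> 'a"
  assumes \<epsilon>: "0 < \<epsilon>" "\<epsilon> < 1" and "0 < R"
    and out: "\<And>x. R \<le> dist x 0 \<Longrightarrow> dist (f x) 0 \<le> \<epsilon> * dist x 0"
    and inside: "\<And>x. dist x 0 \<le> R \<Longrightarrow> dist (f x) 0 \<le> R"
  shows "periodic_points f \<subseteq> f ` cball 0 R"
proof
  fix p assume p: "p \<in> periodic_points f"
  have "dist q 0 \<le> R" if q: "q \<in> periodic_points f" for q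
  proof (rule ccontr)
    assume "\<not> dist q 0 \<le> R"
    obtain n where n: "n \<ge> 1" "(f ^^ n) q = q"
      using q by (auto simp: periodic_points_def)
    have "dist ((f ^^ k) q) 0 \<le> max R (\<epsilon> ^ k * dist q 0)" for k
    proof (induction k)
      case (Suc k)
      show ?case
      proof (cases "dist ((f ^^ k) q) 0 \<le> R")
        case True
        then show ?thesis using inside by (simp add: le_max_iff_disj)
      next
        case False
        with Suc.IH have "dist ((f ^^ k) q) 0 \<le> \<epsilon> ^ k * dist q 0" by simp
        then have "\<epsilon> * dist ((f ^^ k) q) 0 \<le> \<epsilon> * (\<epsilon> ^ k * dist q 0)"
          using \<epsilon>(1) by (intro mult_left_mono) auto
        moreover have "dist (f ((f ^^ k) q)) 0 \<le> \<epsilon> * dist ((f ^^ k) q) 0"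
          using False by (intro out) simp
        ultimately show ?thesis by (simp add: le_max_iff_disj mult.assoc)
      qed
    qed simp
    from this[of n] n(2) \<open>\<not> dist q 0 \<le> R\<close> have "dist q 0 \<le> \<epsilon> ^ n * dist q 0" by simp
    moreover have "\<epsilon> ^ n * dist q 0 < 1 * dist q 0"
      using \<epsilon> n(1) \<open>\<not> dist q 0 \<le> R\<close> \<open>0 < R\<close>
        power_decreasing[OF n(1), of \<epsilon>]
      by (intro mult_strict_right_mono) auto
    ultimately show False by simp
  qed
  moreover obtain n where n: "n \<ge> 1" "(f ^^ n) p = p"
    using p by (auto simp: periodic_points_def)
  moreover have "p = f ((f ^^ (n - 1)) p)"
    using n by (cases n) auto
  ultimately show "p \<in> f ` cball 0 R"
    using periodic_points_funpow[OF p, of "n - 1"]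
    by (intro image_eqI[of p f "(f ^^ (n - 1)) p"]) (simp_all add: dist_commute[of 0])
qed


text \<open>The estimate is obtained first for single points of the attracting ball, which shadow a periodic
  orbit after at most \<open>N\<close> steps; then for all single points, with a factor growing linearly with
  the distance to \<open>0\<close>, because outside the ball that distance shrinks by \<open>\<epsilon>\<close> in each step;
  finally for pairs. A pair is either contracted by \<open>\<epsilon>\<close> in the next step, which allows induction,
  or else its points are at distance at least \<open>\<delta>\<close> with one of them in the ball. Then \<open>d(x, y)\<close>
  dominates the factors in the estimates for the single points, up to a constant, and these
  estimates suffice.\<close>

lemma superexponential_decay:
  fixes f :: "'a::{complete_space,zero} \<Rightarrow> 'a" and E :: "'a \<Rightarrow> 'b::real_normed_vector"
  assumes lip: "L-lipschitz_on UNIV f" and base: "f 0 = 0"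
    and flat: "uniformly_locally_flat f" and inf: "flat_at_infinity f"
    and tb: "\<And>R. totally_bounded (f ` cball 0 R)"
    and E: "K-lipschitz_on UNIV E" and E0: "\<And>q. q \<in> periodic_points f \<Longrightarrow> E q = 0"
    and \<epsilon>: "0 < \<epsilon>" "\<epsilon> \<le> 1/2"
  shows "\<exists>C\<ge>0. \<forall>n x y. norm (E ((f ^^ n) x) - E ((f ^^ n) y)) \<le> C * \<epsilon> ^ n * dist x y"
proof -
  have K: "K \<ge> 0" by (rule lipschitz_on_nonneg[OF E])
  have EK: "norm (E a - E b) \<le> K * dist a b" for a b
    using lipschitz_onD[OF E, of a b] by (simp add: dist_norm)
  have "(0::'a) \<in> periodic_points f"
    using base by (auto simp: periodic_points_def intro!: exI[of _ 1])
  then have EK0: "norm (E a) \<le> K * dist a 0" for a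
    using EK[of a 0] E0 by simp
  obtain \<delta> where \<delta>: "0 < \<delta>"
    "\<And>x y. dist x y < \<delta> \<Longrightarrow> dist (f x) (f y) \<le> \<epsilon> * dist x y"
    using flat \<epsilon>(1) unfolding uniformly_locally_flat_def by blast
  have \<epsilon>1: "0 \<le> \<epsilon>" "\<epsilon> \<le> 1" using \<epsilon> by auto
  obtain R where R: "1 / \<epsilon> \<le> R" "0 < R"
    "\<And>x. R \<le> dist x 0 \<Longrightarrow> dist (f x) 0 \<le> \<epsilon> * dist x 0"
    "\<And>x. dist x 0 \<le> R \<Longrightarrow> dist (f x) 0 \<le> R"
    "\<And>x y. R \<le> dist x 0 \<Longrightarrow> R \<le> dist y 0 \<Longrightarrow> dist (f x) (f y) \<le> \<epsilon> * dist x y"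
    using flat_at_infinity_attracting_ball[OF lip base inf \<epsilon>(1) \<epsilon>1(2)] by metis
  have inv: "f ` cball 0 R \<subseteq> cball 0 R"
    using R(4) by (auto simp: dist_commute)
  obtain N where N: "\<And>x. x \<in> cball 0 R \<Longrightarrow>
      \<exists>i\<le>N. \<exists>q\<in>periodic_points f. dist ((f ^^ i) x) q < \<delta>"
    using orbit_approaches_periodic_point[OF \<delta>(2) \<epsilon>1(1) \<epsilon>(2) \<delta>(1) tb inv] by blast
  define C1 where "C1 = K * (\<delta> + R) / \<epsilon> ^ N"
  have "C1 \<ge> 0" using K \<delta>(1) R(2) \<epsilon>(1) by (simp add: C1_def)
  have step1: "norm (E ((f ^^ n) x)) \<le> C1 * \<epsilon> ^ n" if x: "dist x 0 \<le> R" for x n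
  proof -
    obtain i q where iq: "i \<le> N" "q \<in> periodic_points f" "dist ((f ^^ i) x) q < \<delta>"
      using N[of x] x by (auto simp: dist_commute)
    have "norm (E ((f ^^ n) x)) * \<epsilon> ^ N \<le> K * (\<delta> + R) * \<epsilon> ^ n"
    proof (cases "i \<le> n")
      case True
      define k where "k = n - i"
      have n: "n = k + i" using True by (simp add: k_def)
      have "norm (E ((f ^^ n) x)) \<le> K * dist ((f ^^ n) x) ((f ^^ k) q)"
        using EK[of "(f ^^ n) x" "(f ^^ k) q"] E0[OF periodic_points_funpow[OF iq(2)]] by simp
      also have "\<dots> = K * dist ((f ^^ k) ((f ^^ i) x)) ((f ^^ k) q)"
        by (simp add: n funpow_add)
      also have "\<dots> \<le> K * (\<epsilon> ^ k * dist ((f ^^ i) x) q)"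
        by (intro mult_left_mono K dist_funpow_le[OF \<delta>(2) \<epsilon>1 iq(3)])
      also have "\<dots> \<le> K * (\<epsilon> ^ k * (\<delta> + R))"
        using iq(3) R(2) K \<epsilon>1 by (intro mult_left_mono) auto
      finally have "norm (E ((f ^^ n) x)) * \<epsilon> ^ N \<le> K * (\<epsilon> ^ k * (\<delta> + R)) * \<epsilon> ^ i"
        using iq(1) \<epsilon>1 K \<delta>(1) R(2) by (intro mult_mono power_decreasing) auto
      then show ?thesis by (simp add: n power_add mult_ac)
    next
      case False
      have "dist ((f ^^ n) x) 0 \<le> R" using x R(4) by (induction n) auto
      then have "norm (E ((f ^^ n) x)) \<le> K * (\<delta> + R)"
        using EK0[of "(f ^^ n) x"] K \<delta>(1)
        by (meson add_increasing less_imp_le mult_left_mono order_trans)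
      then show ?thesis
        using False iq(1) \<epsilon>1 K \<delta>(1) R(2) by (intro mult_mono power_decreasing) auto
    qed
    then show ?thesis using \<epsilon>(1) by (simp add: C1_def field_simps)
  qed
  \<comment> \<open>The summand \<open>K\<close> covers \<open>n = 0\<close>.\<close>
  define C2 where "C2 = C1 + K"
  have C2: "C1 \<le> C2" "K \<le> C2" "0 \<le> C2" using K \<open>C1 \<ge> 0\<close> by (auto simp: C2_def)
  have step2: "norm (E ((f ^^ n) x)) \<le> C2 * \<epsilon> ^ n * max 1 (dist x 0)" for x n
  proof (induction n arbitrary: x)
    case 0
    have "norm (E x) \<le> K * dist x 0" by (rule EK0)
    also have "\<dots> \<le> C2 * max 1 (dist x 0)" using C2 by (intro mult_mono) auto
    finally show ?case by simp
  next
    case (Suc n)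
    show ?case
    proof (cases "dist x 0 \<le> R")
      case True
      have "norm (E ((f ^^ Suc n) x)) \<le> C1 * \<epsilon> ^ Suc n * 1" using step1[OF True, of "Suc n"] by simp
      also have "\<dots> \<le> C2 * \<epsilon> ^ Suc n * max 1 (dist x 0)"
        using C2 \<epsilon>1 by (intro mult_mono) auto
      finally show ?thesis .
    next
      case False
      \<comment> \<open>The radius is at least \<open>1 / \<epsilon>\<close>, so the constant 1 under the maximum loses a factor as well.\<close>
      have "1 \<le> \<epsilon> * R" using R(1) \<epsilon>(1) by (simp add: field_simps)
      also have "\<dots> \<le> \<epsilon> * dist x 0" using False \<epsilon>1 by (intro mult_left_mono) auto
      finally have *: "max 1 (dist (f x) 0) \<le> \<epsilon> * max 1 (dist x 0)"
        using R(3)[of x] False mult_left_mono[of "dist x 0" "max 1 (dist x 0)" \<epsilon>] \<epsilon>1 by auto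
      have "norm (E ((f ^^ Suc n) x)) \<le> C2 * \<epsilon> ^ n * max 1 (dist (f x) 0)"
        using Suc.IH[of "f x"] by (simp only: funpow_Suc_right comp_apply)
      also have "\<dots> \<le> C2 * \<epsilon> ^ n * (\<epsilon> * max 1 (dist x 0))"
        using C2 \<epsilon>1 * by (intro mult_left_mono) auto
      finally show ?thesis by (simp add: mult_ac)
    qed
  qed
  define C3 where "C3 = K + C2 * ((2 + 2 * R) / \<delta> + 1)"
  have C3: "K \<le> C3" "C2 * ((2 + 2 * R) / \<delta> + 1) \<le> C3" "0 \<le> C3"
    using K C2 \<delta>(1) R(2) by (auto simp: C3_def)
  have far: "norm (E ((f ^^ n) x) - E ((f ^^ n) y)) \<le> C3 * \<epsilon> ^ n * dist x y"
    if xy: "\<delta> \<le> dist x y" "dist y 0 \<le> R" for n x y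
  proof -
    have "dist x 0 \<le> dist x y + R" using dist_triangle[of x 0 y] xy(2) by simp
    then have "max 1 (dist x 0) \<le> 1 + R + dist x y" "max 1 (dist y 0) \<le> 1 + R"
      using xy(2) R(2) zero_le_dist[of x y] by (intro max.boundedI; linarith)+
    then have "max 1 (dist x 0) + max 1 (dist y 0) \<le> (2 + 2 * R) + dist x y"
      by linarith
    also have "2 + 2 * R \<le> (2 + 2 * R) / \<delta> * dist x y"
      using xy(1) \<delta>(1) R(2) mult_left_mono[of \<delta> "dist x y" "2 + 2 * R"]
      by (simp add: pos_le_divide_eq)
    finally have *: "max 1 (dist x 0) + max 1 (dist y 0) \<le> ((2 + 2 * R) / \<delta> + 1) * dist x y"
      by (simp add: distrib_right)
    have "norm (E ((f ^^ n) x) - E ((f ^^ n) y)) \<le> norm (E ((f ^^ n) x)) + norm (E ((f ^^ n) y))"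
      by (rule norm_triangle_ineq4)
    also have "\<dots> \<le> C2 * \<epsilon> ^ n * max 1 (dist x 0) + C2 * \<epsilon> ^ n * max 1 (dist y 0)"
      by (intro add_mono step2)
    also have "\<dots> = C2 * \<epsilon> ^ n * (max 1 (dist x 0) + max 1 (dist y 0))"
      by (simp add: distrib_left)
    also have "\<dots> \<le> C2 * \<epsilon> ^ n * (((2 + 2 * R) / \<delta> + 1) * dist x y)"
      using C2 \<epsilon>1 by (intro mult_left_mono *) auto
    also have "\<dots> = C2 * ((2 + 2 * R) / \<delta> + 1) * (\<epsilon> ^ n * dist x y)"
      by (simp add: mult_ac)
    also have "\<dots> \<le> C3 * (\<epsilon> ^ n * dist x y)"
      using C3 \<epsilon>1 by (intro mult_right_mono) auto
    finally show ?thesis by (simp add: mult.assoc)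
  qed
  have "norm (E ((f ^^ n) x) - E ((f ^^ n) y)) \<le> C3 * \<epsilon> ^ n * dist x y" for n x y
  proof (induction n arbitrary: x y)
    case 0
    show ?case using EK[of x y] C3(1) mult_right_mono[of K C3 "dist x y"] by simp
  next
    case (Suc n)
    have contr: ?case if "dist (f x) (f y) \<le> \<epsilon> * dist x y"
    proof -
      have "norm (E ((f ^^ Suc n) x) - E ((f ^^ Suc n) y)) \<le> C3 * \<epsilon> ^ n * dist (f x) (f y)"
        using Suc.IH[of "f x" "f y"] by (simp only: funpow_Suc_right comp_apply)
      also have "\<dots> \<le> C3 * \<epsilon> ^ n * (\<epsilon> * dist x y)"
        using that C3 \<epsilon>1 by (intro mult_left_mono) auto
      finally show ?thesis by (simp add: mult_ac)
    qed
    consider "dist x y < \<delta>" | "R \<le> dist x 0" "R \<le> dist y 0"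
      | "\<delta> \<le> dist x y" "dist y 0 \<le> R" | "\<delta> \<le> dist x y" "dist x 0 \<le> R"
      by linarith
    then show ?case
    proof cases
      case 4
      with far[of y x "Suc n"] show ?thesis by (simp add: dist_commute norm_minus_commute)
    qed (use contr \<delta>(2) R(5) far in blast)+
  qed
  with C3(3) show ?thesis by blast
qed


section \<open>Inverting a translate of an operator modulo a polynomial in it\<close>

text \<open>\<open>S\<close> is the Neumann series \<open>- (\<Sum>k. z\<^sup>-\<^sup>k\<^sup>-\<^sup>1 T\<^sup>k)\<close> of \<open>(T - z)\<^sup>-\<^sup>1\<close> multiplied by \<open>W\<close>: the factor
  \<open>W\<close> makes it converge although \<open>T\<close> may have spectrum outside the disc of radius \<open>r\<close>.\<close>

lemma neumann_series_right_factor: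
  fixes T W :: "'a::{complex_normed_vector,banach} \<Rightarrow> 'a"
  assumes T: "bounded_clinear T" and W: "bounded_clinear W"
    and comm: "\<And>u. W (T u) = T (W u)"
    and C: "0 \<le> C" and bound: "\<And>k u. norm ((T ^^ k) (W u)) \<le> C * r ^ k * norm u"
    and r: "0 \<le> r" "r < cmod z"
  obtains S where "bounded_clinear S" and "\<And>u. T (S u) - z *\<^sub>C S u = W u"
    and "\<And>u. S (T u - z *\<^sub>C u) = W u"
proof -
  have z: "z \<noteq> 0" using r by auto
  define q where "q = r / cmod z"
  have q: "0 \<le> q" "q < 1" using r z by (auto simp: q_def)
  define a where "a u k = inverse z ^ k *\<^sub>C (T ^^ k) (W u)" for u k
  have a_le: "norm (a u k) \<le> C * norm u * q ^ k" for u k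
  proof -
    have "norm (a u k) = inverse (cmod z) ^ k * norm ((T ^^ k) (W u))"
      by (simp add: a_def norm_scaleC norm_power norm_inverse)
    also have "\<dots> \<le> inverse (cmod z) ^ k * (C * r ^ k * norm u)"
      by (intro mult_left_mono bound) simp
    finally show ?thesis by (simp add: q_def power_divide field_simps)
  qed
  have geo: "summable (\<lambda>k. C * norm u * q ^ k)" for u
    using q by (intro summable_mult summable_geometric) auto
  have sm: "summable (a u)" for u
    by (rule summable_comparison_test'[OF geo a_le])
  have Tk: "bounded_clinear (\<lambda>u. (T ^^ k) (W u))" for k
    by (rule bounded_clinear_compose[OF bounded_clinear_funpow[OF T] W])
  have lin: "bounded_clinear (\<lambda>u. a u k)" for k
    unfolding a_def by (rule bounded_clinear_scaleC[OF Tk])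
  define G where "G u = (\<Sum>k. a u k)" for u
  have G: "bounded_clinear G"
    unfolding bounded_clinear_def
  proof (intro conjI allI)
    show "bounded_linear G"
    proof (rule bounded_linear_intro[where K = "C * (\<Sum>k. q ^ k)"])
      show "G (u + v) = G u + G v" for u v
        unfolding G_def bounded_clinearD(3)[OF lin] by (rule suminf_add[OF sm sm, symmetric])
      show "G (t *\<^sub>R u) = t *\<^sub>R G u" for t u
        unfolding G_def bounded_clinearD(6)[OF lin] by (rule suminf_scaleR_right[OF sm, symmetric])
      show "norm (G u) \<le> norm u * (C * (\<Sum>k. q ^ k))" for u
      proof -
        have "norm (G u) \<le> (\<Sum>k. C * norm u * q ^ k)"
          unfolding G_def by (rule norm_suminf_le[OF a_le geo])
        also have "\<dots> = norm u * (C * (\<Sum>k. q ^ k))"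
          using q by (simp add: suminf_mult summable_geometric mult_ac)
        finally show ?thesis .
      qed
    qed
    show "G (c *\<^sub>C u) = c *\<^sub>C G u" for c u
      unfolding G_def bounded_clinearD(2)[OF lin]
      by (rule bounded_linear.suminf[OF bounded_linear_scaleC sm, symmetric])
  qed
  have aSuc: "T (a u k) = z *\<^sub>C a u (Suc k)" for u k
    using z by (simp add: a_def bounded_clinearD(2)[OF T] scaleC_scaleC)
  have TG: "z *\<^sub>C G u - T (G u) = z *\<^sub>C W u" for u
  proof -
    have "T (G u) = (\<Sum>k. T (a u k))"
      unfolding G_def by (rule bounded_linear.suminf[OF bounded_clinearD(1)[OF T] sm])
    also have "\<dots> = z *\<^sub>C (\<Sum>k. a u (Suc k))"
      unfolding aSuc using sm
      by (intro bounded_linear.suminf[OF bounded_linear_scaleC, symmetric])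
        (simp add: summable_Suc_iff)
    also have "\<dots> = z *\<^sub>C (G u - a u 0)"
      unfolding G_def by (simp add: suminf_split_head[OF sm])
    finally show ?thesis by (simp add: a_def complex_vector.scale_right_diff_distrib)
  qed
  have GT: "G (T u) = T (G u)" for u
  proof -
    have "a (T u) k = T (a u k)" for k
      by (simp add: a_def comm bounded_clinearD(2)[OF T] funpow_swap1)
    then have "a (T u) = (\<lambda>k. T (a u k))" by (rule ext)
    then show ?thesis
      unfolding G_def
      by (simp add: bounded_linear.suminf[OF bounded_clinearD(1)[OF T] sm])
  qed
  define S where "S u = (- inverse z) *\<^sub>C G u" for u
  have S: "bounded_clinear S"
    unfolding S_def by (rule bounded_clinear_scaleC[OF G])
  have TS: "T (S u) - z *\<^sub>C S u = W u" for u
  proof -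
    have "T (S u) - z *\<^sub>C S u = inverse z *\<^sub>C (z *\<^sub>C G u - T (G u))"
      unfolding S_def bounded_clinearD(2)[OF T]
      by (simp add: complex_vector.scale_right_diff_distrib scaleC_scaleC mult.commute)
    also have "\<dots> = W u" using z by (simp add: TG scaleC_scaleC)
    finally show ?thesis .
  qed
  have "S (T u) = T (S u)" for u
    unfolding S_def GT bounded_clinearD(2)[OF T] ..
  then have "S (T u - z *\<^sub>C u) = T (S u) - z *\<^sub>C S u" for u
    by (simp add: bounded_clinearD(2,4)[OF S])
  with S TS show ?thesis by (intro that) auto
qed

text \<open>For \<open>W = p(T)\<close> and \<open>w = p(z)\<close> this is the factorisation \<open>p(T) - p(z) = (T - z) V\<close>. Instead of
  introducing polynomials in an operator, the lemmas below show that the pairs \<open>(W, w)\<close> for which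
  it holds contain \<open>(1, 1)\<close> and are stable under multiplication by \<open>(T, z)\<close> and under differences.\<close>

definition divides_modulo :: "('a::complex_normed_vector \<Rightarrow> 'a) \<Rightarrow> complex \<Rightarrow> ('a \<Rightarrow> 'a) \<Rightarrow> complex \<Rightarrow> bool"
  where "divides_modulo T z W w \<longleftrightarrow> (\<exists>V. bounded_clinear V \<and> (\<forall>u. V (T u) = T (V u)) \<and>
    (\<forall>u. T (V u) - z *\<^sub>C V u = W u - w *\<^sub>C u))"

lemma divides_modulo_one: "divides_modulo T z (\<lambda>u. u) 1" if "bounded_clinear T"
  unfolding divides_modulo_def
  by (rule exI[of _ "\<lambda>_. 0"])
    (use bounded_clinearD(5)[OF that] in \<open>simp add: bounded_clinear_zero\<close>)

lemma divides_modulo_compose: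
  assumes T: "bounded_clinear T" and dv: "divides_modulo T z W w"
  shows "divides_modulo T z (\<lambda>u. T (W u)) (z * w)"
proof -
  obtain V where V: "bounded_clinear V" "\<And>u. V (T u) = T (V u)"
    "\<And>u. T (V u) - z *\<^sub>C V u = W u - w *\<^sub>C u"
    using dv by (auto simp: divides_modulo_def)
  show ?thesis
    unfolding divides_modulo_def
  proof (intro exI[of _ "\<lambda>u. T (V u) + w *\<^sub>C u"] conjI allI)
    show "bounded_clinear (\<lambda>u. T (V u) + w *\<^sub>C u)"
      by (intro bounded_clinear_add bounded_clinear_compose[OF T] V(1) bounded_clinear_scaleC
          bounded_clinear_id)
    show "T (V (T u)) + w *\<^sub>C T u = T (T (V u) + w *\<^sub>C u)" for u
      by (simp add: V(2) bounded_clinearD(2,3)[OF T])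
    show "T (T (V u) + w *\<^sub>C u) - z *\<^sub>C (T (V u) + w *\<^sub>C u) = T (W u) - (z * w) *\<^sub>C u" for u
    proof -
      have "T (T (V u)) - z *\<^sub>C T (V u) = T (W u) - w *\<^sub>C T u"
        using arg_cong[OF V(3)[of u], of T] by (simp add: bounded_clinearD(2,4)[OF T])
      then show ?thesis
        by (simp add: bounded_clinearD(2,3)[OF T] scaleC_add_right scaleC_scaleC algebra_simps)
    qed
  qed
qed

lemma divides_modulo_diff:
  assumes T: "bounded_clinear T" and dv: "divides_modulo T z W w" "divides_modulo T z W' w'"
  shows "divides_modulo T z (\<lambda>u. W u - W' u) (w - w')"
proof -
  obtain V where V: "bounded_clinear V" "\<And>u. V (T u) = T (V u)"
    "\<And>u. T (V u) - z *\<^sub>C V u = W u - w *\<^sub>C u"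
    using dv(1) by (auto simp: divides_modulo_def)
  obtain V' where V': "bounded_clinear V'" "\<And>u. V' (T u) = T (V' u)"
    "\<And>u. T (V' u) - z *\<^sub>C V' u = W' u - w' *\<^sub>C u"
    using dv(2) by (auto simp: divides_modulo_def)
  show ?thesis
    unfolding divides_modulo_def
  proof (intro exI[of _ "\<lambda>u. V u - V' u"] conjI allI)
    show "bounded_clinear (\<lambda>u. V u - V' u)"
      by (intro bounded_clinear_diff V(1) V'(1))
    show "V (T u) - V' (T u) = T (V u - V' u)" for u
      by (simp add: V(2) V'(2) bounded_clinearD(4)[OF T])
    show "T (V u - V' u) - z *\<^sub>C (V u - V' u) = W u - W' u - (w - w') *\<^sub>C u" for u
    proof -
      have "T (V u - V' u) - z *\<^sub>C (V u - V' u)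
          = (T (V u) - z *\<^sub>C V u) - (T (V' u) - z *\<^sub>C V' u)"
        by (simp add: bounded_clinearD(4)[OF T] complex_vector.scale_right_diff_distrib)
      then show ?thesis
        by (simp add: V(3) V'(3) complex_vector.scale_left_diff_distrib)
    qed
  qed
qed

text \<open>The value at \<open>u\<close> of the product of the operators \<open>T\<^sup>n - 1\<close>. These commute, so the product
  vanishes at every \<open>u\<close> with \<open>T\<^sup>n u = u\<close> for some \<open>n\<close> in the list.\<close>

fun cycle_annihilator :: "('a::complex_normed_vector \<Rightarrow> 'a) \<Rightarrow> nat list \<Rightarrow> 'a \<Rightarrow> 'a"
  where "cycle_annihilator T [] u = u"
  | "cycle_annihilator T (n # ns) u =
      (T ^^ n) (cycle_annihilator T ns u) - cycle_annihilator T ns u"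

lemma bounded_clinear_cycle_annihilator:
  assumes T: "bounded_clinear T"
  shows "bounded_clinear (cycle_annihilator T ns)"
proof (induction ns)
  case Nil
  have "cycle_annihilator T [] = (\<lambda>u. u)" by (rule ext) simp
  then show ?case using bounded_clinear_id by simp
next
  case (Cons n ns)
  have "bounded_clinear (\<lambda>u. (T ^^ n) (cycle_annihilator T ns u) - cycle_annihilator T ns u)"
    by (intro bounded_clinear_diff bounded_clinear_compose[OF bounded_clinear_funpow[OF T]]
        Cons.IH)
  then show ?case by (simp only: cycle_annihilator.simps[abs_def])
qed

lemma cycle_annihilator_commute:
  assumes T: "bounded_clinear T"
  shows "cycle_annihilator T ns ((T ^^ k) u) = (T ^^ k) (cycle_annihilator T ns u)"
proof (induction ns)
  case (Cons n ns)
  have "(T ^^ n) ((T ^^ k) v) = (T ^^ k) ((T ^^ n) v)" for v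
    by (metis add.commute comp_apply funpow_add)
  with Cons.IH show ?case
    by (simp add: bounded_clinearD(4)[OF bounded_clinear_funpow[OF T]])
qed simp

lemma cycle_annihilator_eq_0:
  assumes T: "bounded_clinear T" and "n \<in> set ns" and "(T ^^ n) u = u"
  shows "cycle_annihilator T ns u = 0"
  using assms(2)
proof (induction ns)
  case (Cons m ns)
  show ?case
  proof (cases "m = n")
    case True
    then show ?thesis
      using assms(3) by (simp flip: cycle_annihilator_commute[OF T])
  next
    case False
    with Cons show ?thesis
      by (simp add: bounded_clinearD(5)[OF bounded_clinear_funpow[OF T]])
  qed
qed simp

lemma divides_modulo_cycle_annihilator:
  assumes T: "bounded_clinear T"
  shows "divides_modulo T z (cycle_annihilator T ns) (\<Prod>n\<leftarrow>ns. z ^ n - 1)"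
proof (induction ns)
  case Nil
  show ?case using divides_modulo_one[OF T] by (simp add: divides_modulo_def)
next
  case (Cons n ns)
  let ?W = "cycle_annihilator T ns" and ?w = "\<Prod>n\<leftarrow>ns. z ^ n - 1"
  have "divides_modulo T z (\<lambda>u. (T ^^ n) (?W u)) (z ^ n * ?w)"
  proof (induction n)
    case 0
    show ?case using Cons.IH by simp
  next
    case (Suc n)
    show ?case using divides_modulo_compose[OF T Suc.IH] by (simp add: mult.assoc)
  qed
  from divides_modulo_diff[OF T this Cons.IH] show ?case
    by (simp add: divides_modulo_def left_diff_distrib)
qed

text \<open>With \<open>(T - z) S = W\<close> from the Neumann series and \<open>(T - z) V = W - w\<close> from division, the
  difference satisfies \<open>(T - z) (S - V) = w\<close>, and \<open>w\<close> is nonzero by the assumption on \<open>z\<close>. Both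
  \<open>S\<close> and \<open>V\<close> commute with \<open>T\<close>, so the inverse is two-sided.\<close>

lemma not_in_operator_spectrum:
  fixes T :: "'a::{complex_normed_vector,banach} \<Rightarrow> 'a"
  assumes T: "bounded_clinear T"
    and C: "0 \<le> C"
    and bound: "\<And>k u. norm ((T ^^ k) (cycle_annihilator T ns u)) \<le> C * r ^ k * norm u"
    and r: "0 \<le> r" "r < cmod z" and z: "\<And>n. n \<in> set ns \<Longrightarrow> z ^ n \<noteq> 1"
  shows "z \<notin> operator_spectrum T"
proof -
  let ?W = "cycle_annihilator T ns" and ?w = "\<Prod>n\<leftarrow>ns. z ^ n - 1"
  have w: "?w \<noteq> 0" using z by (induction ns) auto
  have comm: "?W (T u) = T (?W u)" for u
    using cycle_annihilator_commute[OF T, of ns 1 u] by simp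
  obtain S where S: "bounded_clinear S" "\<And>u. T (S u) - z *\<^sub>C S u = ?W u"
    "\<And>u. S (T u - z *\<^sub>C u) = ?W u"
    using neumann_series_right_factor[OF T bounded_clinear_cycle_annihilator[OF T] comm C bound r]
    by blast
  obtain V where V: "bounded_clinear V" "\<And>u. V (T u) = T (V u)"
    "\<And>u. T (V u) - z *\<^sub>C V u = ?W u - ?w *\<^sub>C u"
    using divides_modulo_cycle_annihilator[OF T, of z ns] by (auto simp: divides_modulo_def)
  have V': "V (T u - z *\<^sub>C u) = ?W u - ?w *\<^sub>C u" for u
    by (simp add: bounded_clinearD(2,4)[OF V(1)] V(2,3))
  define U where "U u = inverse ?w *\<^sub>C (S u - V u)" for u
  have "bounded_clinear U"
    unfolding U_def by (intro bounded_clinear_scaleC bounded_clinear_diff S V)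
  moreover have "U (T u - z *\<^sub>C u) = u" for u
    using w by (simp add: U_def S V' scaleC_scaleC)
  moreover have "T (U u) - z *\<^sub>C U u = u" for u
  proof -
    have "T (U u) - z *\<^sub>C U u
        = inverse ?w *\<^sub>C ((T (S u) - z *\<^sub>C S u) - (T (V u) - z *\<^sub>C V u))"
      by (simp add: U_def bounded_clinearD(2,4)[OF T] complex_vector.scale_right_diff_distrib
          scaleC_scaleC mult.commute)
    also have "\<dots> = u" using w by (simp add: S V scaleC_scaleC)
    finally show ?thesis .
  qed
  ultimately show ?thesis
    unfolding operator_spectrum_def by blast
qed

lemma eigenvalue_in_operator_spectrum:
  assumes "u \<noteq> 0" and "T u = z *\<^sub>C u"
  shows "z \<in> operator_spectrum T"
proof -
  have False if "bounded_clinear S" "\<And>x. S (T x - z *\<^sub>C x) = x" for S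
    using that(2)[of u] assms bounded_clinearD(5)[OF that(1)] by simp
  then show ?thesis
    unfolding operator_spectrum_def by blast
qed


section \<open>The spectrum of a compact Lipschitz operator\<close>

lemma finite_periodic_points_of_flat:
  fixes f :: "'a::{metric_space,zero} \<Rightarrow> 'a"
  assumes lip: "L-lipschitz_on UNIV f" and base: "f 0 = 0"
    and flat: "uniformly_locally_flat f" and inf: "flat_at_infinity f"
    and tb: "\<And>R. totally_bounded (f ` cball 0 R)"
  shows "finite (periodic_points f)"
proof -
  obtain \<delta> where \<delta>: "0 < \<delta>" "\<And>x y. dist x y < \<delta> \<Longrightarrow> dist (f x) (f y) \<le> 1/2 * dist x y"
    using flat unfolding uniformly_locally_flat_def by (meson half_gt_zero zero_less_one)
  obtain R where R: "0 < R" "\<And>x. R \<le> dist x 0 \<Longrightarrow> dist (f x) 0 \<le> 1/2 * dist x 0"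
    "\<And>x. dist x 0 \<le> R \<Longrightarrow> dist (f x) 0 \<le> R"
    by (rule flat_at_infinity_attracting_ball[OF lip base inf, of "1/2" 0]) (auto intro: that)
  have "periodic_points f \<subseteq> f ` cball 0 R"
    by (rule periodic_points_in_attracting_ball[OF _ _ R]) auto
  then show ?thesis
    by (intro finite_periodic_points[OF \<delta>(2) _ _ \<delta>(1) tb]) auto
qed

lemma periodic_point_of_order_unique:
  assumes "periodic_point_of_order f m x" and "periodic_point_of_order f n x"
  shows "m = n"
  using assms unfolding periodic_point_of_order_def
  by (metis Suc_pred' linorder_neqE_nat less_Suc_eq_le not_one_le_zero not_gr_zero)

lemma periodic_pointE:
  assumes "x \<in> periodic_points f"
  obtains n where "periodic_point_of_order f n x"
proof -
  let ?P = "\<lambda>n. n \<ge> 1 \<and> (f ^^ n) x = x"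
  have "\<exists>n. ?P n" using assms by (auto simp: periodic_points_def)
  then have "?P (Least ?P)" by (rule LeastI_ex)
  moreover have "(f ^^ k) x \<noteq> x" if "1 \<le> k" "k \<le> Least ?P - 1" for k
    using not_less_Least[of k ?P] that by auto
  ultimately have "periodic_point_of_order f (Least ?P) x"
    by (simp add: periodic_point_of_order_def)
  then show ?thesis by (rule that)
qed

lemma finite_periods:
  assumes "finite (periodic_points f)"
  shows "finite {n. \<exists>x. x \<noteq> 0 \<and> periodic_point_of_order f n x}"
proof (rule finite_subset)
  show "{n. \<exists>x. x \<noteq> 0 \<and> periodic_point_of_order f n x}
      \<subseteq> (\<lambda>x. THE n. periodic_point_of_order f n x) ` periodic_points f"
  proof
    fix n assume "n \<in> {n. \<exists>x. x \<noteq> 0 \<and> periodic_point_of_order f n x}"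
    then obtain x where x: "periodic_point_of_order f n x" by blast
    then have "(THE n. periodic_point_of_order f n x) = n"
      using periodic_point_of_order_unique by (intro the_equality) auto
    moreover have "x \<in> periodic_points f"
      using x by (auto simp: periodic_points_def periodic_point_of_order_def)
    ultimately show "n \<in> (\<lambda>x. THE n. periodic_point_of_order f n x) ` periodic_points f"
      by (metis imageI)
  qed
qed (use assms in simp)

lemma lipfree_map_funpow_delta:
  assumes "L-lipschitz_on UNIV f" and "f 0 = 0"
  shows "(lipfree_map f ^^ k) (lipfree_delta x) = lipfree_delta ((f ^^ k) x)"
  by (induction k) (simp_all add: lipfree_map(2)[OF assms])

text \<open>The eigenvector \<open>\<Sum>k<n. z\<^sup>-\<^sup>k \<delta>(f\<^sup>k x)\<close> is nonzero because some Lipschitz function vanishes at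
  \<open>0\<close> and on the rest of the cycle but not at \<open>x\<close>.\<close>

lemma root_of_unity_in_spectrum:
  fixes f :: "'a::{metric_space,zero} \<Rightarrow> 'a"
  assumes lip: "L-lipschitz_on UNIV f" and base: "f 0 = 0"
    and x: "x \<noteq> 0" "periodic_point_of_order f n x" and z: "z ^ n = 1"
  shows "z \<in> operator_spectrum (lipfree_map f)"
proof (rule eigenvalue_in_operator_spectrum)
  note T = lipfree_map[OF lip base]
  have n: "n \<ge> 1" "(f ^^ n) x = x" "\<And>k. 1 \<le> k \<Longrightarrow> k < n \<Longrightarrow> (f ^^ k) x \<noteq> x"
    using x(2) by (auto simp: periodic_point_of_order_def)
  have z0: "z \<noteq> 0" using z n(1) by (cases "z = 0") (auto simp: power_0_left)
  define b where "b k = inverse z ^ k *\<^sub>C lipfree_delta ((f ^^ k) x)" for k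
  define u where "u = (\<Sum>k<n. b k)"
  have Tb: "lipfree_map f (b k) = z *\<^sub>C b (Suc k)" for k
    using z0 by (simp add: b_def bounded_clinearD(2)[OF T(1)] T(2) scaleC_scaleC)
  have bn: "b n = b 0"
    using z n(2) by (simp add: b_def power_inverse)
  have "lipfree_map f u = (\<Sum>k<n. lipfree_map f (b k))"
    unfolding u_def by (rule linear_sum[OF bounded_linear.linear[OF bounded_clinearD(1)[OF T(1)]]])
  also have "\<dots> = z *\<^sub>C (\<Sum>k<n. b (Suc k))"
    unfolding Tb by (rule complex_vector.scale_sum_right[symmetric])
  also have "(\<Sum>k<n. b (Suc k)) = u"
    using sum.lessThan_Suc_shift[of b n] bn by (simp add: u_def)
  finally show "lipfree_map f u = z *\<^sub>C u" .
  \<comment> \<open>The distance to the rest of the orbit and to the base point separates \<open>x\<close> from them.\<close>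
  define F where "F = insert 0 ((\<lambda>k. (f ^^ k) x) ` {1..<n})"
  have F: "finite F" "x \<notin> F" "F \<noteq> {}"
    using x(1) n(3) by (auto simp: F_def) metis
  obtain g where g: "norm g \<le> 1"
    "\<And>y. lip0_apply g y = complex_of_real (infdist y F - infdist 0 F)"
  proof (rule lip0_of_real_lipschitz[of "\<lambda>y. infdist y F"])
    show "\<bar>infdist a F - infdist b F\<bar> \<le> dist a b" for a b
      by (rule infdist_triangle_abs)
  qed auto
  have gF: "lip0_apply g y = 0" if "y \<in> F" for y
    using that by (simp add: g F_def)
  have gx: "lip0_apply g x \<noteq> 0"
  proof -
    have "infdist x F \<noteq> 0"
      using in_closed_iff_infdist_zero[OF finite_imp_closed[OF F(1)] F(3)] F(2) by blast
    moreover have "infdist 0 F = 0" by (simp add: F_def)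
    ultimately show ?thesis by (simp add: g)
  qed
  note lin = bounded_clinear_lipfree_pairing[of g]
  have "lipfree_pairing u g = (\<Sum>k<n. lipfree_pairing (b k) g)"
    unfolding u_def by (rule linear_sum[OF bounded_linear.linear[OF bounded_clinearD(1)[OF lin]]])
  also have "\<dots> = (\<Sum>k<n. if k = 0 then lip0_apply g x else 0)"
  proof (rule sum.cong)
    show "lipfree_pairing (b k) g = (if k = 0 then lip0_apply g x else 0)" if "k \<in> {..<n}" for k
      using that gF[of "(f ^^ k) x"]
      by (auto simp: b_def bounded_clinearD(2)[OF lin] lipfree_pairing_delta scaleC_complex_def F_def)
  qed simp
  also have "\<dots> = lip0_apply g x" using n(1) by simp
  finally show "u \<noteq> 0"
    using gx bounded_clinearD(5)[OF lin] by auto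
qed

text \<open>The product \<open>W\<close> of the \<open>T\<^sup>n - 1\<close> kills \<open>\<delta>(q)\<close> for every periodic point \<open>q\<close>: if \<open>q \<noteq> 0\<close>, then
  \<open>T\<^sup>n\<close> fixes \<open>\<delta>(q)\<close> for the period \<open>n\<close> of \<open>q\<close>, and at the base point \<open>\<delta>(0) = 0\<close>. So
  \<open>W \<circ> \<delta>\<close> decays along orbits, and by
  \<open>norm_le_of_lipfree_delta_lipschitz\<close> this decay is a bound for the norms of \<open>T\<^sup>k W\<close>.\<close>

lemma spectrum_subset_roots_of_unity:
  fixes f :: "'a::{complete_space,zero} \<Rightarrow> 'a"
  assumes lip: "L-lipschitz_on UNIV f" and base: "f 0 = 0"
    and comp: "compact_operator (lipfree_map f)" and inf: "flat_at_infinity f"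
    and z: "z \<noteq> 0" "\<And>n x. x \<noteq> 0 \<Longrightarrow> periodic_point_of_order f n x \<Longrightarrow> z ^ n \<noteq> 1"
  shows "z \<notin> operator_spectrum (lipfree_map f)"
proof -
  note T = lipfree_map[OF lip base]
  let ?T = "lipfree_map f"
  have flat: "uniformly_locally_flat f"
    by (rule uniformly_locally_flat_of_compact[OF lip base comp])
  have tb: "totally_bounded (f ` cball 0 R)" for R
    by (rule totally_bounded_lipschitz_image_cball[OF lip base comp])
  have "finite {n. \<exists>x. x \<noteq> 0 \<and> periodic_point_of_order f n x}"
    by (intro finite_periods finite_periodic_points_of_flat[OF lip base flat inf tb])
  then obtain ns where ns: "set ns = {n. \<exists>x. x \<noteq> 0 \<and> periodic_point_of_order f n x}"
    by (meson finite_list)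
  let ?W = "cycle_annihilator ?T ns"
  have W: "bounded_clinear ?W" by (rule bounded_clinear_cycle_annihilator[OF T(1)])
  define E where "E x = ?W (lipfree_delta x)" for x
  have E: "(onorm ?W)-lipschitz_on UNIV E"
  proof (rule lipschitz_onI)
    show "dist (E x) (E y) \<le> onorm ?W * dist x y" for x y
      using onorm[OF bounded_clinearD(1)[OF W], of "lipfree_delta x - lipfree_delta y"]
      by (simp add: E_def dist_norm[of "?W _"] bounded_clinearD(4)[OF W] dist_lipfree_delta
          flip: dist_norm[of "lipfree_delta _"])
  qed (rule onorm_pos_le[OF bounded_clinearD(1)[OF W]])
  have E0: "E q = 0" if "q \<in> periodic_points f" for q
  proof (cases "q = 0")
    case True
    then show ?thesis by (simp add: E_def lipfree_delta_base bounded_clinearD(5)[OF W])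
  next
    case False
    obtain n where n: "periodic_point_of_order f n q"
      using \<open>q \<in> periodic_points f\<close> by (rule periodic_pointE)
    then have "(?T ^^ n) (lipfree_delta q) = lipfree_delta q"
      by (simp add: lipfree_map_funpow_delta[OF lip base] periodic_point_of_order_def)
    moreover have "n \<in> set ns" using ns n False by blast
    ultimately show ?thesis
      unfolding E_def by (intro cycle_annihilator_eq_0[OF T(1)])
  qed
  define r where "r = min (1/2) (cmod z / 2)"
  have r: "0 < r" "r \<le> 1/2" "r < cmod z"
    using z(1) by (auto simp: r_def min_def)
  obtain C where C: "C \<ge> 0"
    "\<And>n x y. norm (E ((f ^^ n) x) - E ((f ^^ n) y)) \<le> C * r ^ n * dist x y"
    using superexponential_decay[OF lip base flat inf tb E E0 r(1,2)] by blast
  have "norm ((?T ^^ k) (?W u)) \<le> C * r ^ k * norm u" for k u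
  proof (rule norm_le_of_lipfree_delta_lipschitz)
    show "bounded_clinear (\<lambda>u. (?T ^^ k) (?W u))"
      by (rule bounded_clinear_compose[OF bounded_clinear_funpow[OF T(1)] W])
    show "0 \<le> C * r ^ k" using C(1) r(1) by simp
    have "(?T ^^ k) (?W (lipfree_delta x)) = E ((f ^^ k) x)" for x
      by (simp add: E_def lipfree_map_funpow_delta[OF lip base]
          flip: cycle_annihilator_commute[OF T(1)])
    then show "norm ((?T ^^ k) (?W (lipfree_delta x)) - (?T ^^ k) (?W (lipfree_delta y)))
        \<le> C * r ^ k * dist x y" for x y
      using C(2) by simp
  qed
  then show ?thesis
    using r z ns by (intro not_in_operator_spectrum[OF T(1) C(1), where r = r]) auto
qed

theorem theorem1:
  fixes f :: "'a::{complete_space,zero} \<Rightarrow> 'a"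
    and A :: "nat set"
  assumes "\<exists>L. L-lipschitz_on UNIV f"
    and "f 0 = 0"
    and "compact_operator (lipfree_map f)"
    and "A = {n. n \<ge> 1 \<and> (\<exists>x. x \<noteq> 0 \<and> periodic_point_of_order f n x)}"
    and "bounded (UNIV :: 'a set) \<or> flat_at_infinity f"
  shows "operator_spectrum (lipfree_map f) - {0} = (\<Union>n\<in>A. {z :: complex. z ^ n = 1})"
proof -
  obtain L where L: "L-lipschitz_on UNIV f" using assms(1) by blast
  have inf: "flat_at_infinity f"
    using assms(5) flat_at_infinity_of_bounded by blast
  have A: "n \<in> A \<longleftrightarrow> (\<exists>x. x \<noteq> 0 \<and> periodic_point_of_order f n x)" for n
    by (auto simp: assms(4) periodic_point_of_order_def)
  show ?thesis
  proof (intro equalityI subsetI)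
    fix z assume "z \<in> operator_spectrum (lipfree_map f) - {0}"
    then show "z \<in> (\<Union>n\<in>A. {z. z ^ n = 1})"
      using spectrum_subset_roots_of_unity[OF L assms(2,3) inf, of z] A by auto
  next
    fix z :: complex assume "z \<in> (\<Union>n\<in>A. {z. z ^ n = 1})"
    then obtain n x where nx: "x \<noteq> 0" "periodic_point_of_order f n x" "z ^ n = 1"
      using A by auto
    then have "z \<noteq> 0"
      by (auto simp: periodic_point_of_order_def power_0_left)
    with root_of_unity_in_spectrum[OF L assms(2) nx]
    show "z \<in> operator_spectrum (lipfree_map f) - {0}" by simp
  qed
qed

end
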